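(* Consider the generalized linear model with natural link and the Bridge estimator $\hat{\boldsymbol\beta}_\lambda$ described in the context, with known $\gamma\in(0,1)$ and tuning parameter $\lambda_n=n^{(\gamma_0-2)/2}\lambda$, where $\lambda>0$ is fixed and $\gamma_0\in(\gamma,1]$. Assume conditions (C1) and (C2) on the regressors, as listed in the context. Then, as $n\to\infty$, the Bridge estimator has the sparsity property $$\mathrm P(\hat{\boldsymbol\beta}_\lambda^{(1)}=\boldsymbol 0)\to1,$$ and it satisfies $$n^{1/2}(\hat{\boldsymbol\beta}_\lambda^{(2)}-\boldsymbol\beta^{*(2)})=\boldsymbol J^{(22)-1}\boldsymbol s_n^{(2)}+\mathrm o_{\rm p}(1)$$ when $\gamma_0\in(\gamma,1)$, and $$n^{1/2}(\hat{\boldsymbol\beta}_\lambda^{(2)}-\boldsymbol\beta^{*(2)})=\boldsymbol J^{(22)-1}(\boldsymbol s_n^{(2)}-\lambda\boldsymbol\eta'^{(2)})+\mathrm o_{\rm p}(1)$$ when $\gamma_0=1$, where $\boldsymbol\eta'^{(2)}=(\gamma\,\mathrm{sgn}(\beta_j^* )|\beta_j^*|^{\gamma-1})_{j\in\mathcal J^{(2)}}$ and $\mathrm{sgn}$ is the sign function.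
   Context: Model. Let $f(\boldsymbol y;\boldsymbol\theta)=\exp\{\boldsymbol y^{\rm T}\boldsymbol\theta-a(\boldsymbol\theta)+b(\boldsymbol y)\}$ be a natural exponential family of densities on $\mathbb R^r$ with respect to a $\sigma$-finite measure, where $\boldsymbol\theta\in\Theta\subset\mathbb R^r$ and $\Theta$ is the natural parameter space (those $\boldsymbol\theta$ for which the normalizing integral of $\exp\{\boldsymbol y^{\rm T}\boldsymbol\theta+b(\boldsymbol y)\}$ is positive and finite); $\Theta^\circ$ is its interior. It is assumed that $\mathrm V[\boldsymbol y]=a''(\boldsymbol\theta)$ is positive definite (primes denote gradient and Hessian). The data are $(\boldsymbol y_i,\boldsymbol X_i)$, $i=1,\dots,n$, with $\boldsymbol y_i$ independent $r$-dimensional random vectors and $\boldsymbol X_i\in\mathcal X\subset\mathbb R^{r\times p}$ known constant matrices; $\boldsymbol y_i$ has density $f(\cdot;\boldsymbol X_i\boldsymbol\beta^* )$, where $\boldsymbol\beta^*\in\mathcal B$ is the true parameter and $\mathcal B\subset\mathbb R^p$ is an open convex set; $p$ and $r$ are fixed and $n\to\infty$. The log-likelihood of $\boldsymbol y_i$ is $g_i(\boldsymbol\beta)=\boldsymbol y_i^{\rm T}\boldsymbol X_i\boldsymbol\beta-a(\boldsymbol X_i\boldsymbol\beta)+b(\boldsymbol y_i)$. Conditions on regressors. (C1) $\mathcal X$ is compact and $\boldsymbol X\boldsymbol\beta\in\Theta^\circ$ for all $\boldsymbol X\in\mathcal X$, $\boldsymbol\beta\in\mathcal B$. (C2) There exists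 an invariant distribution $\mu$ on $\mathcal X$; in particular, $n^{-1}\sum_{i=1}^n\boldsymbol X_i^{\rm T}a''(\boldsymbol X_i\boldsymbol\beta)\boldsymbol X_i$ converges to a positive-definite matrix $\boldsymbol J(\boldsymbol\beta)=\int_{\mathcal X}\boldsymbol X^{\rm T}a''(\boldsymbol X\boldsymbol\beta)\boldsymbol X\,\mu(\mathrm d\boldsymbol X)$. Bridge estimator. $\hat{\boldsymbol\beta}_\lambda=\mathrm{argmin}_{\boldsymbol\beta\in\mathcal B}\{-\sum_{i=1}^n g_i(\boldsymbol\beta)+n\lambda_n\sum_{j=1}^p|\beta_j|^\gamma\}$. Notation. $\boldsymbol J=\boldsymbol J(\boldsymbol\beta^* )$; $\boldsymbol s_n=n^{-1/2}\sum_{i=1}^n g_i'(\boldsymbol\beta^* )$; $\mathcal J^{(1)}=\{j:\beta_j^*=0\}$, $\mathcal J^{(2)}=\{j:\beta_j^*\ne0\}$; for a vector $\boldsymbol u\in\mathbb R^p$, $\boldsymbol u^{(k)}=(u_j)_{j\in\mathcal J^{(k)}}$; $\boldsymbol J^{(22)}=(\boldsymbol J_{ij})_{i,j\in\mathcal J^{(2)}}$ and $\boldsymbol J^{(22)-1}$ is its inverse. *)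

theory Defs
  imports "HOL-Probability.Probability"
begin

definition gradient :: "('a::real_inner \<Rightarrow> real) \<Rightarrow> 'a \<Rightarrow> 'a" where
  "gradient f x = (THE D. GDERIV f x :> D)"

definition hessian :: "(real^'k \<Rightarrow> real) \<Rightarrow> real^'k \<Rightarrow> real^'k^'k" where
  "hessian f x = jacobian (gradient f) (at x)"

definition pos_def :: "real^'k^'k \<Rightarrow> bool" where
  "pos_def A \<longleftrightarrow> transpose A = A \<and> (\<forall>v. v \<noteq> 0 \<longrightarrow> 0 < v \<bullet> (A *v v))"

definition natural_parameter_space ::
    "(real^'r) measure \<Rightarrow> (real^'r \<Rightarrow> real) \<Rightarrow> (real^'r) set" where
  "natural_parameter_space \<nu> b =
     {\<theta>. 0 < (\<integral>\<^sup>+v. ennreal (exp (v \<bullet> \<theta> + b v)) \<partial>\<nu>) \<and>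
         (\<integral>\<^sup>+v. ennreal (exp (v \<bullet> \<theta> + b v)) \<partial>\<nu>) < \<infinity>}"

text \<open>In the density \<open>exp (y \<bullet> \<theta> - a \<theta> + b y)\<close> the function \<open>a\<close> is determined, on the natural
  parameter space, by the requirement that the density integrates to one.\<close>

definition cumulant :: "(real^'r) measure \<Rightarrow> (real^'r \<Rightarrow> real) \<Rightarrow> real^'r \<Rightarrow> real" where
  "cumulant \<nu> b \<theta> = ln (\<integral>v. exp (v \<bullet> \<theta> + b v) \<partial>\<nu>)"

definition nef_density ::
    "(real^'r) measure \<Rightarrow> (real^'r \<Rightarrow> real) \<Rightarrow> real^'r \<Rightarrow> real^'r \<Rightarrow> real" where
  "nef_density \<nu> b \<theta> v = exp (v \<bullet> \<theta> - cumulant \<nu> b \<theta> + b v)"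

definition loglik ::
    "(real^'r) measure \<Rightarrow> (real^'r \<Rightarrow> real) \<Rightarrow> real^'p^'r \<Rightarrow> real^'r \<Rightarrow> real^'p \<Rightarrow> real" where
  "loglik \<nu> b X v \<beta> = v \<bullet> (X *v \<beta>) - cumulant \<nu> b (X *v \<beta>) + b v"

definition bridge_objective ::
    "(real^'r) measure \<Rightarrow> (real^'r \<Rightarrow> real) \<Rightarrow> (nat \<Rightarrow> real^'p^'r) \<Rightarrow> real \<Rightarrow> real \<Rightarrow>
     nat \<Rightarrow> (nat \<Rightarrow> real^'r) \<Rightarrow> real^'p \<Rightarrow> real" where
  "bridge_objective \<nu> b X \<gamma> lam n y \<beta> =
     - (\<Sum>i\<in>{1..n}. loglik \<nu> b (X i) (y i) \<beta>) + real n * lam * (\<Sum>j\<in>UNIV. \<bar>\<beta> $ j\<bar> powr \<gamma>)"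

text \<open>The objective is not convex and \<open>\<B>\<close> is open, so that a minimizer need be neither unique
  nor, for a given outcome, attained. The estimator is any random vector which is a minimizer
  for every outcome admitting one; its value is arbitrary at the remaining outcomes.\<close>

definition bridge_estimator ::
    "'w measure \<Rightarrow> (real^'r) measure \<Rightarrow> (real^'r \<Rightarrow> real) \<Rightarrow> (real^'p) set \<Rightarrow>
     (nat \<Rightarrow> real^'p^'r) \<Rightarrow> real \<Rightarrow> (nat \<Rightarrow> real) \<Rightarrow> (nat \<Rightarrow> 'w \<Rightarrow> real^'r) \<Rightarrow>
     (nat \<Rightarrow> 'w \<Rightarrow> real^'p) \<Rightarrow> bool" where
  "bridge_estimator M \<nu> b \<B> X \<gamma> lam y est \<longleftrightarrow>
     (\<forall>n. est n \<in> borel_measurable M \<and>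
       (\<forall>\<omega>\<in>space M.
         (\<exists>\<beta>. is_arg_min (bridge_objective \<nu> b X \<gamma> (lam n) n (\<lambda>i. y i \<omega>)) (\<lambda>\<beta>. \<beta> \<in> \<B>) \<beta>) \<longrightarrow>
         is_arg_min (bridge_objective \<nu> b X \<gamma> (lam n) n (\<lambda>i. y i \<omega>)) (\<lambda>\<beta>. \<beta> \<in> \<B>) (est n \<omega>)))"

definition score ::
    "(real^'r) measure \<Rightarrow> (real^'r \<Rightarrow> real) \<Rightarrow> (nat \<Rightarrow> real^'p^'r) \<Rightarrow> real^'p \<Rightarrow>
     (nat \<Rightarrow> 'w \<Rightarrow> real^'r) \<Rightarrow> nat \<Rightarrow> 'w \<Rightarrow> real^'p" where
  "score \<nu> b X \<beta> y n \<omega> =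
     real n powr (- 1 / 2) *\<^sub>R (\<Sum>i\<in>{1..n}. gradient (loglik \<nu> b (X i) (y i \<omega>)) \<beta>)"

definition weighted_gram ::
    "(real^'r) measure \<Rightarrow> (real^'r \<Rightarrow> real) \<Rightarrow> real^'p \<Rightarrow> real^'p^'r \<Rightarrow> real^'p^'p" where
  "weighted_gram \<nu> b \<beta> X = transpose X ** hessian (cumulant \<nu> b) (X *v \<beta>) ** X"

definition info_matrix ::
    "(real^'r) measure \<Rightarrow> (real^'r \<Rightarrow> real) \<Rightarrow> (real^'p^'r) measure \<Rightarrow> real^'p \<Rightarrow> real^'p^'p" where
  "info_matrix \<nu> b \<mu> \<beta> = (\<integral>X. weighted_gram \<nu> b \<beta> X \<partial>\<mu>)"

definition cond_C1 ::
    "(real^'r) measure \<Rightarrow> (real^'r \<Rightarrow> real) \<Rightarrow> (real^'p) set \<Rightarrow> (real^'p^'r) set \<Rightarrow> bool" where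
  "cond_C1 \<nu> b \<B> \<X> \<longleftrightarrow>
     compact \<X> \<and> (\<forall>X\<in>\<X>. \<forall>\<beta>\<in>\<B>. X *v \<beta> \<in> interior (natural_parameter_space \<nu> b))"

text \<open>The invariance of \<open>\<mu>\<close> enters only through the stated convergence of the sample averages,
  which is weaker than weak convergence of the empirical distributions of the regressors
  to \<open>\<mu>\<close>.\<close>

definition cond_C2 ::
    "(real^'r) measure \<Rightarrow> (real^'r \<Rightarrow> real) \<Rightarrow> (real^'p) set \<Rightarrow> (real^'p^'r) set \<Rightarrow>
     (nat \<Rightarrow> real^'p^'r) \<Rightarrow> (real^'p^'r) measure \<Rightarrow> bool" where
  "cond_C2 \<nu> b \<B> \<X> X \<mu> \<longleftrightarrow>
     prob_space \<mu> \<and> sets \<mu> = sets (restrict_space borel \<X>) \<and>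
     (\<forall>\<beta>\<in>\<B>.
        ((\<lambda>n. (1 / real n) *\<^sub>R (\<Sum>i\<in>{1..n}. weighted_gram \<nu> b \<beta> (X i)))
           \<longlonglongrightarrow> info_matrix \<nu> b \<mu> \<beta>) \<and>
        pos_def (info_matrix \<nu> b \<mu> \<beta>))"

text \<open>The subvector of \<open>u\<close> with indices in \<open>S\<close> is represented by \<open>u\<close> with the other entries
  replaced by \<open>0\<close>, and likewise for submatrices. Under this representation sums, norms and
  products agree with those of the subvectors and submatrices; the identity matrix on \<open>S\<close> is
  \<open>submat S (mat 1)\<close>.\<close>

definition subvec :: "'k set \<Rightarrow> real^'k \<Rightarrow> real^'k" where
  "subvec S u = (\<chi> j. if j \<in> S then u $ j else 0)"

definition submat :: "'k set \<Rightarrow> real^'k^'k \<Rightarrow> real^'k^'k" where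
  "submat S A = (\<chi> i j. if i \<in> S \<and> j \<in> S then A $ i $ j else 0)"

definition submat_inv :: "'k set \<Rightarrow> real^'k^'k \<Rightarrow> real^'k^'k" where
  "submat_inv S A =
     (SOME K. submat S K = K \<and> submat S A ** K = submat S (mat 1) \<and>
              K ** submat S A = submat S (mat 1))"

definition small_op_one ::
    "'w measure \<Rightarrow> (nat \<Rightarrow> 'w \<Rightarrow> 'a::real_normed_vector) \<Rightarrow> bool" where
  "small_op_one M Z \<longleftrightarrow> (\<forall>\<epsilon>>0. (\<lambda>n. \<P>(\<omega> in M. \<epsilon> < norm (Z n \<omega>))) \<longlonglongrightarrow> 0)"

end

theory Submission
  imports Defs
begin

text \<open>In the local coordinate \<open>u = sqrt n (\<beta> - \<beta>\<^sub>0)\<close> the objective increases by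
  \<open>V n s u = - s \<bullet> u + D n u + lam * pen n u\<close> with \<open>s\<close> the score. The link being natural,
  \<open>D n\<close> does not depend on the responses: it is convex, nonnegative, and tends to
  \<open>u \<bullet> (J *v u) / 2\<close> uniformly on bounded sets. The data enter only through \<open>s\<close>, so everything
  except the tightness of the score is deterministic and uniform over \<open>norm s \<le> S\<close>. Convexity
  makes \<open>D n\<close> grow at least linearly off a ball, with slope proportional to its radius, which beats
  both \<open>s \<bullet> u\<close> and the at most linear decrease of the penalty; hence minimizers exist and stay
  bounded. On the coordinates with \<open>\<beta>\<^sub>0 $ j = 0\<close> the penalty is
  \<open>n powr ((\<gamma>\<^sub>0 - \<gamma>) / 2) * \<bar>u $ j\<bar> powr \<gamma>\<close>, which dominates the Lipschitz remainder, so these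
  coordinates of a minimizer vanish; on the others it is asymptotically linear, with slope tending to
  \<open>0\<close> if \<open>\<gamma>\<^sub>0 < 1\<close>, and the minimizer is close to that of the limiting quadratic.\<close>

section \<open>Matrices\<close>

text \<open>The penalty is not convex, so convergence of minimizers cannot be inferred from
  pointwise convergence of convex objectives, and consistency of the estimator is not assumed. Once
  minimizers are confined to a ball, each is compared with just two explicit competitors: its own
  truncation to the nonzero coordinates, and the minimizer of the limiting quadratic over the
  vectors supported there. The exponents come from one count. As \<open>n * n powr
  ((\<gamma>\<^sub>0 - 2) / 2) = n powr (\<gamma>\<^sub>0 / 2)\<close>, a zero coordinate, penalized
  at \<open>u $ j / sqrt n\<close>, carries the factor
  \<open>n powr (\<gamma>\<^sub>0 / 2 - \<gamma> / 2)\<close>, which diverges because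
  \<open>\<gamma> < \<gamma>\<^sub>0\<close>. At a nonzero coordinate differentiation yields a slope
  proportional to \<open>n powr (\<gamma>\<^sub>0 / 2 - 1 / 2)\<close>, bounded because
  \<open>\<gamma>\<^sub>0 \<le> 1\<close>. Since the deterministic statements hold for every
  \<open>s\<close> in a ball at once, bounded second moments of the score replace any limit
  law.\<close>

lemma norm_matrix_vector_mult_le:
  fixes A :: "real^'n^'m"
  shows "norm (A *v x) \<le> CARD('m) * norm A * norm x"
proof -
  \<comment> \<open>Here \<open>norm A\<close> is the Euclidean norm of all entries. Adding up the
    row bounds costs the factor \<open>CARD('m)\<close>, which is harmless in fixed
    dimension.\<close>
  have "norm (A *v x) \<le> (\<Sum>i\<in>UNIV. \<bar>(A *v x) $ i\<bar>)" by (rule norm_le_l1_cart)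
  also have "\<dots> \<le> (\<Sum>i\<in>(UNIV::'m set). norm A * norm x)"
  proof (rule sum_mono)
    fix i
    have "\<bar>(A *v x) $ i\<bar> \<le> norm (A $ i) * norm x"
      unfolding matrix_vector_mul_component by (rule Cauchy_Schwarz_ineq2)
    also have "\<dots> \<le> norm A * norm x"
      by (intro mult_right_mono Finite_Cartesian_Product.norm_nth_le) auto
    finally show "\<bar>(A *v x) $ i\<bar> \<le> norm A * norm x" .
  qed
  finally show ?thesis by (simp add: mult.assoc)
qed

lemma abs_quadratic_form_le:
  fixes A :: "real^'n^'n"
  shows "\<bar>x \<bullet> (A *v x)\<bar> \<le> CARD('n) * norm A * (norm x)\<^sup>2"
proof -
  have "\<bar>x \<bullet> (A *v x)\<bar> \<le> norm x * norm (A *v x)" by (rule Cauchy_Schwarz_ineq2)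
  also have "\<dots> \<le> norm x * (CARD('n) * norm A * norm x)"
    by (intro mult_left_mono norm_matrix_vector_mult_le) auto
  finally show ?thesis by (simp add: power2_eq_square mult_ac)
qed

lemma dot_transpose_mult:
  fixes A :: "real^'n^'m"
  shows "x \<bullet> (transpose A *v y) = (A *v x) \<bullet> y"
  by (metis dot_lmul_matrix vector_transpose_matrix)

lemma dot_vector_matrix_mult:
  fixes A :: "real^'n^'m"
  shows "x \<bullet> (y v* A) = (A *v x) \<bullet> y"
  using dot_transpose_mult[of x A y] by simp

text \<open>The constant is the minimum of the quadratic form over the compact unit sphere;
  homogeneity of degree two extends the bound to all vectors.\<close>

lemma pos_def_lower_bound:
  fixes A :: "real^'n^'n"
  assumes "pos_def A"
  shows "\<exists>c>0. \<forall>u. c * (norm u)\<^sup>2 \<le> u \<bullet> (A *v u)"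
proof -
  have "sphere (0::real^'n) 1 \<noteq> {}" by simp
  moreover have "continuous_on (sphere 0 1) (\<lambda>u. u \<bullet> (A *v u))"
    by (intro continuous_intros)
  ultimately obtain u0 where u0: "u0 \<in> sphere 0 1" "\<And>u. u \<in> sphere 0 1 \<Longrightarrow> u0 \<bullet> (A *v u0) \<le> u \<bullet> (A *v u)"
    using continuous_attains_inf[OF compact_sphere, of "0::real^'n" 1 "\<lambda>u. u \<bullet> (A *v u)"] by blast
  have "u0 \<noteq> 0" using u0(1) by auto
  then have "u0 \<bullet> (A *v u0) > 0" using assms by (auto simp: pos_def_def)
  moreover have "u0 \<bullet> (A *v u0) * (norm u)\<^sup>2 \<le> u \<bullet> (A *v u)" for u
  proof (cases "u = 0")
    case False
    define w where "w = (1 / norm u) *\<^sub>R u"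
    have u: "u = norm u *\<^sub>R w" and "w \<in> sphere 0 1" using False by (auto simp: w_def)
    then have "u0 \<bullet> (A *v u0) * (norm u)\<^sup>2 \<le> (w \<bullet> (A *v w)) * (norm u)\<^sup>2"
      by (intro mult_right_mono u0(2)) auto
    also have "\<dots> = u \<bullet> (A *v u)"
      by (subst (2 3) u) (simp add: matrix_vector_mult_scaleR power2_eq_square mult_ac)
    finally show ?thesis .
  qed simp
  ultimately show ?thesis by blast
qed

section \<open>Compression of a matrix to a coordinate subspace, and its inverse\<close>

lemma submat_mat_1_mult:
  "(submat S (mat 1) ** A) $ i $ j = (if i \<in> S then A $ i $ j else 0)"
  "(A ** submat S (mat 1)) $ i $ j = (if j \<in> S then A $ i $ j else 0)"
proof -
  have "(\<Sum>k\<in>UNIV. submat S (mat 1) $ i $ k * A $ k $ j)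
      = (\<Sum>k\<in>UNIV. if k = i then (if i \<in> S then A $ i $ j else 0) else 0)"
    by (intro sum.cong) (auto simp: submat_def mat_def)
  then show "(submat S (mat 1) ** A) $ i $ j = (if i \<in> S then A $ i $ j else 0)"
    by (simp add: matrix_matrix_mult_def)
  have "(\<Sum>k\<in>UNIV. A $ i $ k * submat S (mat 1) $ k $ j)
      = (\<Sum>k\<in>UNIV. if k = j then (if j \<in> S then A $ i $ j else 0) else 0)"
    by (intro sum.cong) (auto simp: submat_def mat_def)
  then show "(A ** submat S (mat 1)) $ i $ j = (if j \<in> S then A $ i $ j else 0)"
    by (simp add: matrix_matrix_mult_def)
qed

text \<open>With \<open>submat S (mat 1)\<close> as the coordinate projection P, a submatrix is P A
  P, so that identities between submatrices follow from associativity and P P = P.\<close>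

lemma submat_eq: "submat S A = submat S (mat 1) ** A ** submat S (mat 1)"
  by (simp add: vec_eq_iff submat_mat_1_mult) (simp add: submat_def)

lemma submat_mat_1_vec: "submat S (mat 1) *v u = subvec S u"
proof -
  have "(\<Sum>k\<in>UNIV. submat S (mat 1) $ i $ k * u $ k)
      = (\<Sum>k\<in>UNIV. if k = i then (if i \<in> S then u $ i else 0) else 0)" for i
    by (intro sum.cong) (auto simp: submat_def mat_def)
  then show ?thesis by (simp add: vec_eq_iff matrix_vector_mult_def subvec_def)
qed

lemma subvec_inner: "subvec S u \<bullet> v = u \<bullet> subvec S v"
  by (auto simp: inner_vec_def subvec_def intro!: sum.cong)

lemma subvec_idem: "subvec S (subvec S u) = subvec S u"
  by (simp add: subvec_def vec_eq_iff)

lemma norm_subvec_le: "norm (subvec S u) \<le> norm u"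
  by (rule norm_le_componentwise_cart) (simp add: subvec_def)

lemma subvec_diff: "subvec S (u - v) = subvec S u - subvec S v"
  by (simp add: vec_eq_iff subvec_def)

lemma subvec_scaleR: "subvec S (c *\<^sub>R u) = c *\<^sub>R subvec S u"
  by (simp add: vec_eq_iff subvec_def)

text \<open>Justifies the choice in \<open>submat_inv\<close>. A zero-padded submatrix is singular
  in general, so it is completed by the identity on the complementary coordinates, inverted in full
  dimension and compressed back.\<close>

lemma submat_inv_exists:
  fixes A :: "real^'n^'n"
  assumes A: "pos_def A"
  shows "\<exists>K. submat S K = K \<and> submat S A ** K = submat S (mat 1) \<and> K ** submat S A = submat S (mat 1)"
proof -
  define P :: "real^'n^'n" where "P = submat S (mat 1)"
  \<comment> \<open>Block diagonal: the submatrix on S and the identity off S. A kernel vector is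
    supported in S, where positive definiteness of A forces it to vanish.\<close>
  define A' where "A' = submat S A + (mat 1 - P)"
  have PP: "P ** P = P" unfolding P_def by (simp add: vec_eq_iff submat_mat_1_mult) (simp add: submat_def)
  have sub: "submat S B = P ** B ** P" for B unfolding P_def by (rule submat_eq)
  have PA': "P ** A' = submat S A" and A'P: "A' ** P = submat S A"
    unfolding P_def A'_def
    by (auto simp: vec_eq_iff submat_mat_1_mult) (auto simp: submat_def mat_def)
  have "x = 0" if "A' *v x = 0" for x
  proof -
    have "0 = P *v (A' *v x)" using that by simp
    also have "\<dots> = submat S A *v x" by (simp add: matrix_vector_mul_assoc PA')
    finally have 1: "submat S A *v x = 0" by simp
    then have "x = P *v x"
      using that by (simp add: A'_def matrix_vector_mult_add_rdistrib matrix_vector_mult_diff_rdistrib)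
    then have x: "subvec S x = x" by (simp add: P_def submat_mat_1_vec)
    have "x \<bullet> (A *v x) = x \<bullet> (submat S A *v x)"
      using x by (metis submat_eq matrix_vector_mul_assoc submat_mat_1_vec subvec_inner)
    then have "x \<bullet> (A *v x) = 0" using 1 by simp
    then show "x = 0" using A by (auto simp: pos_def_def)
  qed
  then obtain B where B: "B ** A' = mat 1"
    using matrix_left_invertible_ker[of A'] by blast
  then have AB: "A' ** B = mat 1" by (simp add: matrix_left_right_inverse)
  \<comment> \<open>Because \<open>A'\<close> commutes with P, so does its inverse; this makes
    \<open>P ** B\<close> a two-sided inverse supported in S.\<close>
  have BP: "B ** P = P ** B"
  proof -
    have "B ** P = B ** P ** (A' ** B)" by (simp add: AB)
    also have "\<dots> = B ** (P ** A') ** B" by (simp add: matrix_mul_assoc)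
    also have "\<dots> = (B ** A') ** P ** B" by (simp add: PA' A'P[symmetric] matrix_mul_assoc)
    finally show ?thesis by (simp add: B)
  qed
  show ?thesis
  proof (intro exI conjI)
    show "submat S (P ** B) = P ** B"
      unfolding sub by (metis BP PP matrix_mul_assoc)
    have "submat S A ** (P ** B) = P ** (A' ** P) ** B" 
      by (simp add: A'P matrix_mul_assoc PA'[symmetric]) (metis A'P PA' PP matrix_mul_assoc)
    also have "\<dots> = P ** P ** (A' ** B)"
      by (simp add: A'P PA'[symmetric] matrix_mul_assoc)
    finally show "submat S A ** (P ** B) = submat S (mat 1)" by (simp add: AB PP P_def[symmetric])
    have "P ** B ** submat S A = P ** (B ** A') ** P"
      by (simp add: A'P[symmetric] matrix_mul_assoc)
    then show "P ** B ** submat S A = submat S (mat 1)" by (simp add: B PP P_def[symmetric])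
  qed
qed

text \<open>The second part is the normal equation of the quadratic
  \<open>u \<bullet> (A *v u) / 2 - u \<bullet> w\<close> on the vectors supported in S:
  \<open>submat_inv S A *v w\<close> is its stationary point there.\<close>

lemma submat_inv_vec:
  fixes A :: "real^'n^'n"
  assumes "pos_def A" "subvec S w = w"
  shows "subvec S (submat_inv S A *v w) = submat_inv S A *v w"
    and "subvec S u = u \<Longrightarrow> u \<bullet> (A *v (submat_inv S A *v w)) = u \<bullet> w"
proof -
  let ?K = "submat_inv S A"
  have K: "submat S ?K = ?K" "submat S A ** ?K = submat S (mat 1)"
    using someI_ex[OF submat_inv_exists[OF assms(1), of S]] unfolding submat_inv_def by blast+
  show 1: "subvec S (?K *v w) = ?K *v w"
    by (metis K(1) assms(2) submat_eq submat_mat_1_vec matrix_vector_mul_assoc subvec_idem)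
  assume u: "subvec S u = u"
  have "u \<bullet> (A *v (?K *v w)) = u \<bullet> (submat S A *v (?K *v w))"
    by (metis u 1 submat_eq submat_mat_1_vec matrix_vector_mul_assoc subvec_inner)
  also have "\<dots> = u \<bullet> (submat S (mat 1) *v w)" by (simp add: matrix_vector_mul_assoc K(2))
  finally show "u \<bullet> (A *v (?K *v w)) = u \<bullet> w" by (simp add: submat_mat_1_vec assms(2))
qed

section \<open>Minimizers of a convex function with a bridge penalty\<close>

text \<open>For \<open>x0 = 0\<close> the junk value \<open>0 powr (\<gamma> - 1) = 0\<close> makes this the trivial bound by
  \<open>0\<close>, so that coordinates need not be distinguished when bounding the penalty below.\<close>

lemma abs_powr_ge_tangent:
  fixes x x0 \<gamma> :: real
  assumes "0 < \<gamma>" "\<gamma> < 1"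
  shows "\<bar>x0\<bar> powr \<gamma> - \<bar>x0\<bar> powr (\<gamma> - 1) * \<bar>x - x0\<bar> \<le> \<bar>x\<bar> powr \<gamma>"
proof (cases "x0 = 0 \<or> \<bar>x0\<bar> \<le> \<bar>x\<bar>")
  case True
  then show ?thesis
  proof
    assume "\<bar>x0\<bar> \<le> \<bar>x\<bar>"
    then have "\<bar>x0\<bar> powr \<gamma> \<le> \<bar>x\<bar> powr \<gamma>" using assms by (intro powr_mono2) auto
    moreover have "0 \<le> \<bar>x0\<bar> powr (\<gamma> - 1) * \<bar>x - x0\<bar>" by simp
    ultimately show ?thesis by linarith
  qed simp
next
  case False
  \<comment> \<open>Homogeneity of degree \<gamma> reduces the claim to
    \<open>t \<le> t powr \<gamma>\<close> for t between 0 and 1.\<close>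
  define t where "t = \<bar>x\<bar> / \<bar>x0\<bar>"
  have t: "0 \<le> t" "t \<le> 1" "\<bar>x\<bar> = \<bar>x0\<bar> * t" using False by (auto simp: t_def divide_simps)
  have "\<bar>x0\<bar> - \<bar>x - x0\<bar> \<le> \<bar>x0\<bar> * t" using t(3) by linarith
  then have "\<bar>x0\<bar> powr (\<gamma> - 1) * (\<bar>x0\<bar> - \<bar>x - x0\<bar>) \<le> \<bar>x0\<bar> powr (\<gamma> - 1) * (\<bar>x0\<bar> * t)"
    by (intro mult_left_mono) auto
  moreover have p: "\<bar>x0\<bar> powr (\<gamma> - 1) * \<bar>x0\<bar> = \<bar>x0\<bar> powr \<gamma>"
    using False by (simp add: powr_mult_base[symmetric] mult.commute powr_diff)
  moreover have "t \<le> t powr \<gamma>"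
  proof (cases "t = 0")
    case False
    then have "t powr 1 \<le> t powr \<gamma>" using t assms by (intro powr_mono') auto
    then show ?thesis using t by simp
  qed simp
  then have "\<bar>x0\<bar> powr \<gamma> * t \<le> \<bar>x0\<bar> powr \<gamma> * t powr \<gamma>" by (intro mult_left_mono) auto
  moreover have "\<bar>x0\<bar> powr \<gamma> * t powr \<gamma> = \<bar>x\<bar> powr \<gamma>"
    using t(1,3) by (simp add: powr_mult)
  ultimately show ?thesis by (simp add: right_diff_distrib mult.assoc[symmetric])
qed

text \<open>Since \<open>f 0 = 0\<close>, convexity bounds f at the point where the segment from 0
  to u meets the sphere by the fraction \<open>R / norm u\<close> of \<open>f u\<close>. A lower
  bound on one sphere thus becomes linear growth outside it.\<close>

lemma convex_on_ray_ge:
  fixes f :: "'a::real_normed_vector \<Rightarrow> real"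
  assumes "convex_on S f" "0 \<in> S" "f 0 = 0" "u \<in> S" "0 < R" "R \<le> norm u"
    and sph: "\<And>w. norm w = R \<Longrightarrow> m \<le> f w"
  shows "norm u / R * m \<le> f u"
proof -
  define t where "t = R / norm u"
  have "0 < norm u" using assms by linarith
  then have t: "0 < t" "t \<le> 1" using assms by (auto simp: t_def)
  have "f ((1 - t) *\<^sub>R 0 + t *\<^sub>R u) \<le> (1 - t) * f 0 + t * f u"
    using assms t by (intro convex_onD[OF assms(1)]) auto
  moreover have "norm (t *\<^sub>R u) = R" using assms by (auto simp: t_def)
  then have "m \<le> f (t *\<^sub>R u)" by (rule sph)
  ultimately have "m \<le> t * f u" using assms(3) by simp
  then have "m / t \<le> f u" using t(1) by (simp add: divide_simps mult.commute)
  then show ?thesis by (simp add: t_def mult.commute)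
qed

text \<open>Separates the optimization argument from the statistical model. The condition
  \<open>n \<ge> 1\<close> makes the scaling by \<open>1 / sqrt (real n)\<close> invertible.
  \<open>D_limit\<close> can range over a whole ball because every ball eventually lies in the
  rescaled domain.\<close>

locale bridge_limit =
  fixes \<beta>\<^sub>0 :: "real^'p" and \<B> :: "(real^'p) set"
    and D :: "nat \<Rightarrow> real^'p \<Rightarrow> real" and J :: "real^'p^'p"
    and \<gamma> \<gamma>\<^sub>0 lam :: real
  assumes open_\<B>: "open \<B>" and \<beta>\<^sub>0: "\<beta>\<^sub>0 \<in> \<B>"
    and D_convex: "n \<ge> 1 \<Longrightarrow> convex_on {u. \<beta>\<^sub>0 + (1 / sqrt (real n)) *\<^sub>R u \<in> \<B>} (D n)"
    and D_0: "D n 0 = 0"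
    and D_nonneg: "n \<ge> 1 \<Longrightarrow> \<beta>\<^sub>0 + (1 / sqrt (real n)) *\<^sub>R u \<in> \<B> \<Longrightarrow> 0 \<le> D n u"
    and D_limit: "\<epsilon> > 0 \<Longrightarrow>
      eventually (\<lambda>n. \<forall>u. norm u \<le> R \<longrightarrow> \<bar>D n u - u \<bullet> (J *v u) / 2\<bar> \<le> \<epsilon>) sequentially"
    and J: "pos_def J"
    and \<gamma>: "0 < \<gamma>" "\<gamma> < 1" "\<gamma> < \<gamma>\<^sub>0" "\<gamma>\<^sub>0 \<le> 1" and lam: "0 < lam"
begin

definition "J1 = {j. \<beta>\<^sub>0 $ j = 0}"
definition "J2 = {j. \<beta>\<^sub>0 $ j \<noteq> 0}"
definition "\<eta> = (\<chi> j. \<gamma> * sgn (\<beta>\<^sub>0 $ j) * \<bar>\<beta>\<^sub>0 $ j\<bar> powr (\<gamma> - 1))"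
definition "local_domain n = {u. \<beta>\<^sub>0 + (1 / sqrt (real n)) *\<^sub>R u \<in> \<B>}"
text \<open>The increment of the penalty in local coordinates, without the factor
  \<open>lam\<close>; the leading power is n times the n-dependent factor of the tuning
  parameter.\<close>

definition "pen n u = real n powr (\<gamma>\<^sub>0 / 2) *
  (\<Sum>j\<in>UNIV. \<bar>(\<beta>\<^sub>0 + (1 / sqrt (real n)) *\<^sub>R u) $ j\<bar> powr \<gamma> - \<bar>\<beta>\<^sub>0 $ j\<bar> powr \<gamma>)"
definition "V n s u = - (s \<bullet> u) + D n u + lam * pen n u"
text \<open>What the penalty contributes in the limit at the nonzero coordinates: its slope there is
  \<open>n powr ((\<gamma>\<^sub>0 - 1) / 2)\<close> times \<open>lam *\<^sub>R \<eta>\<close> to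
  first order.\<close>

definition "bias = (if \<gamma>\<^sub>0 = 1 then lam *\<^sub>R \<eta> else 0)"
text \<open>The minimizer of the limiting quadratic
  \<open>u \<bullet> (J *v u) / 2 - u \<bullet> (s - bias)\<close> over the vectors supported in
  \<open>J2\<close>.\<close>

definition "limit s = submat_inv J2 J *v subvec J2 (s - bias)"

lemma split_subvec: "u = subvec J1 u + subvec J2 u"
  by (auto simp: vec_eq_iff subvec_def J1_def J2_def)

lemma V_0: "V n s 0 = 0"
  by (simp add: V_def D_0 pen_def)

lemma eventually_cball_local_domain: "eventually (\<lambda>n. cball 0 R \<subseteq> local_domain n) sequentially"
proof -
  obtain e where e: "e > 0" "cball \<beta>\<^sub>0 e \<subseteq> \<B>"
    using open_\<B> \<beta>\<^sub>0 open_contains_cball by blast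
  have "(\<lambda>n. 1 / sqrt (real n) * R) \<longlonglongrightarrow> 0" by real_asymp
  then have "eventually (\<lambda>n. 1 / sqrt (real n) * R < e) sequentially"
    using e(1) order_tendstoD(2) by blast
  then show ?thesis
  proof eventually_elim
    case (elim n)
    show ?case
    proof
      fix u :: "real^'p" assume "u \<in> cball 0 R"
      then have "1 / sqrt (real n) * norm u \<le> 1 / sqrt (real n) * R" by (intro mult_left_mono) auto
      then have "\<beta>\<^sub>0 + (1 / sqrt (real n)) *\<^sub>R u \<in> cball \<beta>\<^sub>0 e"
        using elim by (auto simp: dist_norm)
      then show "u \<in> local_domain n" using e(2) by (auto simp: local_domain_def)
    qed
  qed
qed

lemma zero_local_domain: "0 \<in> local_domain n"
  by (simp add: local_domain_def \<beta>\<^sub>0)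

text \<open>Each coordinate moves by at most \<open>norm u / sqrt n\<close>, so the tangent bound
  costs \<open>n powr (\<gamma>\<^sub>0 / 2) / sqrt n\<close> per unit of slope, and this is at most
  1 since \<open>\<gamma>\<^sub>0 \<le> 1\<close>. Hence the rate of decrease is bounded
  independently of n.\<close>

lemma pen_lower: 
  assumes "n \<ge> 1"
  shows "- (\<Sum>j\<in>UNIV. \<bar>\<beta>\<^sub>0 $ j\<bar> powr (\<gamma> - 1)) * norm u \<le> pen n u"
proof -
  let ?K = "\<Sum>j\<in>UNIV. \<bar>\<beta>\<^sub>0 $ j\<bar> powr (\<gamma> - 1)"
  let ?r = "1 / sqrt (real n)"
  have "- (\<bar>\<beta>\<^sub>0 $ j\<bar> powr (\<gamma> - 1) * (?r * norm u))
    \<le> \<bar>(\<beta>\<^sub>0 + ?r *\<^sub>R u) $ j\<bar> powr \<gamma> - \<bar>\<beta>\<^sub>0 $ j\<bar> powr \<gamma>" for j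
  proof -
    have "\<bar>(\<beta>\<^sub>0 + ?r *\<^sub>R u) $ j - \<beta>\<^sub>0 $ j\<bar> \<le> ?r * norm u"
      using component_le_norm_cart[of u j] by (auto simp: abs_mult divide_right_mono)
    then have "\<bar>\<beta>\<^sub>0 $ j\<bar> powr (\<gamma> - 1) * \<bar>(\<beta>\<^sub>0 + ?r *\<^sub>R u) $ j - \<beta>\<^sub>0 $ j\<bar> \<le> \<bar>\<beta>\<^sub>0 $ j\<bar> powr (\<gamma> - 1) * (?r * norm u)"
      by (intro mult_left_mono) auto
    then show ?thesis
      using abs_powr_ge_tangent[OF \<gamma>(1,2), of "\<beta>\<^sub>0 $ j" "(\<beta>\<^sub>0 + ?r *\<^sub>R u) $ j"] by linarith
  qed
  then have "(\<Sum>j\<in>UNIV. - (\<bar>\<beta>\<^sub>0 $ j\<bar> powr (\<gamma> - 1) * (?r * norm u)))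
    \<le> (\<Sum>j\<in>UNIV. \<bar>(\<beta>\<^sub>0 + ?r *\<^sub>R u) $ j\<bar> powr \<gamma> - \<bar>\<beta>\<^sub>0 $ j\<bar> powr \<gamma>)"
    by (rule sum_mono)
  moreover have "(\<Sum>j\<in>UNIV. - (\<bar>\<beta>\<^sub>0 $ j\<bar> powr (\<gamma> - 1) * (?r * norm u))) = - (?K * (?r * norm u))"
    by (simp only: sum_negf sum_distrib_right)
  ultimately have "real n powr (\<gamma>\<^sub>0 / 2) * - (?K * (?r * norm u)) \<le> pen n u"
    unfolding pen_def by (intro mult_left_mono) auto
  moreover have "real n powr (\<gamma>\<^sub>0 / 2) * (?K * (?r * norm u)) \<le> ?K * norm u"
  proof -
    have "real n powr (\<gamma>\<^sub>0 / 2) \<le> sqrt (real n)"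
      using assms \<gamma> powr_mono[of "\<gamma>\<^sub>0 / 2" "1 / 2" "real n"] by (simp add: powr_half_sqrt)
    then have "real n powr (\<gamma>\<^sub>0 / 2) * ?r \<le> 1" using assms by (simp add: divide_simps)
    moreover have "0 \<le> ?K * norm u" by (intro mult_nonneg_nonneg sum_nonneg) auto
    ultimately have "(real n powr (\<gamma>\<^sub>0 / 2) * ?r) * (?K * norm u) \<le> 1 * (?K * norm u)"
      by (rule mult_right_mono)
    then show ?thesis by (simp add: mult_ac)
  qed
  ultimately show ?thesis by simp
qed

section \<open>Localization of the minimizers\<close>

lemma V_pos_outside:
  obtains R where "R > 0"
    "eventually (\<lambda>n. \<forall>s u. norm s \<le> S \<longrightarrow> u \<in> local_domain n \<longrightarrow> R \<le> norm u \<longrightarrow> 0 < V n s u) sequentially"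
proof -
  obtain c where c: "c > 0" "\<And>u. c * (norm u)\<^sup>2 \<le> u \<bullet> (J *v u)"
    using pos_def_lower_bound[OF J] by blast
  define K where "K = (\<Sum>j\<in>UNIV. \<bar>\<beta>\<^sub>0 $ j\<bar> powr (\<gamma> - 1))"
  \<comment> \<open>On the sphere of radius R the convex part is at least
    \<open>c * R\<^sup>2 / 2 - 1\<close>, so off the ball its slope is at least
    \<open>c * R / 2 - 1 / R\<close>. The summand 2 pays for \<open>1 / R \<le> 1\<close> and leaves
    a surplus of 1 over the combined slopes of score and penalty.\<close>
  define R where "R = max 1 (2 * (\<bar>S\<bar> + lam * K + 2) / c)"
  have R: "R \<ge> 1" "\<bar>S\<bar> + lam * K + 2 \<le> c * R / 2"
    using c(1) by (auto simp: R_def max_def field_simps)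
  have "eventually (\<lambda>n. \<forall>u. norm u \<le> R \<longrightarrow> \<bar>D n u - u \<bullet> (J *v u) / 2\<bar> \<le> 1) sequentially"
    by (rule D_limit) simp
  then have "eventually (\<lambda>n. \<forall>s u. norm s \<le> S \<longrightarrow> u \<in> local_domain n \<longrightarrow> R \<le> norm u \<longrightarrow> 0 < V n s u) sequentially"
    using eventually_ge_at_top[of 1]
  proof eventually_elim
    case (elim n)
    show ?case
    proof (intro allI impI)
      fix s u :: "real^'p" assume s: "norm s \<le> S" and u: "u \<in> local_domain n" "R \<le> norm u"
      have "norm u / R * (c * R\<^sup>2 / 2 - 1) \<le> D n u"
      proof (rule convex_on_ray_ge[OF D_convex[OF elim(2)]])
        fix w :: "real^'p" assume w: "norm w = R"
        then have "\<bar>D n w - w \<bullet> (J *v w) / 2\<bar> \<le> 1" using elim(1) by simp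
        moreover have "c * R\<^sup>2 \<le> w \<bullet> (J *v w)" using c(2)[of w] w by simp
        ultimately show "c * R\<^sup>2 / 2 - 1 \<le> D n w" by linarith
      qed (use u R \<beta>\<^sub>0 in \<open>auto simp: D_0 local_domain_def\<close>)
      moreover have "norm u / R * (c * R\<^sup>2 / 2 - 1) = norm u * (c * R / 2 - 1 / R)"
        using R(1) by (simp add: field_simps power2_eq_square)
      moreover have "norm u * (\<bar>S\<bar> + lam * K + 1) \<le> norm u * (c * R / 2 - 1 / R)"
      proof (rule mult_left_mono)
        have "1 / R \<le> 1" using R(1) by simp
        then show "\<bar>S\<bar> + lam * K + 1 \<le> c * R / 2 - 1 / R" using R(2) by linarith
      qed simp
      moreover have "- (norm u * S) \<le> - (s \<bullet> u)"
        using norm_cauchy_schwarz[of s u] mult_right_mono[OF s, of "norm u"] by (simp add: mult.commute)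
      moreover have "norm u * S \<le> norm u * \<bar>S\<bar>" by (intro mult_left_mono) auto
      moreover have "lam * (- K * norm u) \<le> lam * pen n u"
        using pen_lower[OF elim(2), of u] lam unfolding K_def by (intro mult_left_mono) auto
      moreover have "norm u * (\<bar>S\<bar> + lam * K + 1) = norm u * \<bar>S\<bar> - lam * (- K * norm u) + norm u"
        by (simp add: algebra_simps)
      moreover have "0 < norm u" using u(2) R(1) by linarith
      ultimately show "0 < V n s u" unfolding V_def by linarith
    qed
  qed
  moreover have "R > 0" using R(1) by linarith
  ultimately show ?thesis using that by blast
qed

text \<open>Convexity on the open rescaled domain gives continuity of \<open>D n\<close>;
  \<open>0 < \<gamma>\<close> gives continuity of the penalty also where a coordinate passes through
  0.\<close>

lemma V_continuous_on:
  assumes "n \<ge> 1"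
  shows "continuous_on (local_domain n) (V n s)"
proof -
  have "local_domain n = (\<lambda>u. \<beta>\<^sub>0 + (1 / sqrt (real n)) *\<^sub>R u) -` \<B>" by (auto simp: local_domain_def)
  then have "open (local_domain n)"
    by (simp add: open_\<B> continuous_open_vimage)
  then have "continuous_on (local_domain n) (D n)"
    using D_convex[OF assms] unfolding local_domain_def by (intro convex_on_continuous)
  moreover have "continuous_on (local_domain n) (pen n)"
    unfolding pen_def using \<gamma>(1) by (intro continuous_intros continuous_on_powr') auto
  ultimately show ?thesis unfolding V_def by (intro continuous_intros)
qed

definition "is_minimizer n s u \<longleftrightarrow> u \<in> local_domain n \<and> (\<forall>w\<in>local_domain n. V n s u \<le> V n s w)"

text \<open>The benchmark is \<open>V n s 0 = 0\<close>: points of positive value are never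
  minimizers. The minimum over the compact ball is therefore global, although the domain is open and
  possibly unbounded.\<close>

lemma minimizer_exists_bounded:
  obtains R where "R > 0"
    "eventually (\<lambda>n. \<forall>s. norm s \<le> S \<longrightarrow>
       (\<exists>u. is_minimizer n s u) \<and> (\<forall>u. is_minimizer n s u \<longrightarrow> norm u \<le> R)) sequentially"
proof -
  obtain R where R: "R > 0"
    "eventually (\<lambda>n. \<forall>s u. norm s \<le> S \<longrightarrow> u \<in> local_domain n \<longrightarrow> R \<le> norm u \<longrightarrow> 0 < V n s u) sequentially"
    using V_pos_outside .
  from R(2) have "eventually (\<lambda>n. \<forall>s. norm s \<le> S \<longrightarrow>
       (\<exists>u. is_minimizer n s u) \<and> (\<forall>u. is_minimizer n s u \<longrightarrow> norm u \<le> R)) sequentially"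
    using eventually_ge_at_top[of 1] eventually_cball_local_domain[of R]
  proof eventually_elim
    case (elim n)
    show ?case
    proof (intro allI impI conjI)
      fix s :: "real^'p" assume s: "norm s \<le> S"
      have "continuous_on (cball 0 R) (V n s)"
        using V_continuous_on[OF elim(2)] elim(3) by (rule continuous_on_subset)
      then obtain u where u: "u \<in> cball 0 R" "\<And>w. w \<in> cball 0 R \<Longrightarrow> V n s u \<le> V n s w"
        using continuous_attains_inf[of "cball 0 R" "V n s"] R(1) by auto
      have "V n s u \<le> 0" using u(2)[of 0] R(1) by (simp add: V_0)
      have "V n s u \<le> V n s w" if "w \<in> local_domain n" for w
      proof (cases "w \<in> cball 0 R")
        case False
        then have "0 < V n s w" using elim(1) s that by simp
        then show ?thesis using \<open>V n s u \<le> 0\<close> by linarith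
      qed (rule u(2))
      then show "\<exists>u. is_minimizer n s u"
        unfolding is_minimizer_def using u(1) elim(3) by blast
      fix u assume "is_minimizer n s u"
      then have u: "u \<in> local_domain n" and "V n s u \<le> V n s 0"
        using zero_local_domain by (auto simp: is_minimizer_def)
      then have "\<not> 0 < V n s u" by (simp add: V_0)
      then show "norm u \<le> R" using elim(1) s u by force
    qed
  qed
  then show ?thesis using that R(1) by blast
qed

section \<open>Vanishing of the zero coordinates\<close>

text \<open>Truncation leaves the \<open>J2\<close> terms unchanged. A \<open>J1\<close> term is
  \<open>\<bar>u $ j / sqrt n\<bar> powr \<gamma>\<close>, and homogeneity extracts
  \<open>n powr (- \<gamma> / 2)\<close> from it.\<close>

lemma pen_J1:
  assumes "n \<ge> 1"
  shows "pen n u - pen n (subvec J2 u) = real n powr ((\<gamma>\<^sub>0 - \<gamma>) / 2) * (\<Sum>j\<in>J1. \<bar>u $ j\<bar> powr \<gamma>)"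
proof -
  let ?r = "1 / sqrt (real n)"
  have r: "?r powr \<gamma> = real n powr (- \<gamma> / 2)"
    using assms by (simp add: powr_half_sqrt[symmetric] powr_minus_divide[symmetric] powr_powr)
  have "pen n u - pen n (subvec J2 u) = real n powr (\<gamma>\<^sub>0 / 2) *
    (\<Sum>j\<in>UNIV. \<bar>(\<beta>\<^sub>0 + ?r *\<^sub>R u) $ j\<bar> powr \<gamma> - \<bar>(\<beta>\<^sub>0 + ?r *\<^sub>R subvec J2 u) $ j\<bar> powr \<gamma>)"
    unfolding pen_def by (simp add: right_diff_distrib[symmetric] sum_subtractf)
  also have "(\<Sum>j\<in>UNIV. \<bar>(\<beta>\<^sub>0 + ?r *\<^sub>R u) $ j\<bar> powr \<gamma> - \<bar>(\<beta>\<^sub>0 + ?r *\<^sub>R subvec J2 u) $ j\<bar> powr \<gamma>)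
    = (\<Sum>j\<in>UNIV. if j \<in> J1 then ?r powr \<gamma> * \<bar>u $ j\<bar> powr \<gamma> else 0)"
  proof (rule sum.cong[OF refl])
    fix j
    show "\<bar>(\<beta>\<^sub>0 + ?r *\<^sub>R u) $ j\<bar> powr \<gamma> - \<bar>(\<beta>\<^sub>0 + ?r *\<^sub>R subvec J2 u) $ j\<bar> powr \<gamma>
        = (if j \<in> J1 then ?r powr \<gamma> * \<bar>u $ j\<bar> powr \<gamma> else 0)"
      using \<gamma>(1)
      by (auto simp: J1_def J2_def subvec_def abs_mult powr_mult[symmetric])
  qed
  also have "\<dots> = ?r powr \<gamma> * (\<Sum>j\<in>J1. \<bar>u $ j\<bar> powr \<gamma>)"
    by (simp add: sum.If_cases sum_distrib_left)
  also have "real n powr (\<gamma>\<^sub>0 / 2) * \<dots> = (real n powr (\<gamma>\<^sub>0 / 2) * ?r powr \<gamma>) * (\<Sum>j\<in>J1. \<bar>u $ j\<bar> powr \<gamma>)"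
    by (simp only: mult.assoc)
  also have "real n powr (\<gamma>\<^sub>0 / 2) * ?r powr \<gamma> = real n powr ((\<gamma>\<^sub>0 - \<gamma>) / 2)"
    unfolding r by (simp add: powr_add[symmetric] diff_divide_distrib)
  finally show ?thesis .
qed

text \<open>Slopes of a convex function grow along a segment, so bounds on a ball of twice the radius
  make it Lipschitz on the inner ball.\<close>

lemma convex_on_diff_le:
  fixes f :: "'a::real_normed_vector \<Rightarrow> real"
  assumes "convex_on S f" "cball 0 (2 * R) \<subseteq> S" "0 < R"
    and "norm u \<le> R" "norm (w - u) \<le> R"
    and bd: "\<And>z. norm z \<le> 2 * R \<Longrightarrow> 0 \<le> f z \<and> f z \<le> C"
  shows "f w - f u \<le> C / R * norm (w - u)"
proof (cases "w = u")
  case False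
  define t where "t = norm (w - u) / R"
  \<comment> \<open>The segment from u through w is prolonged to distance R from u, which keeps z in
    the ball of radius \<open>2 * R\<close>.\<close>
  define z where "z = u + (1 / t) *\<^sub>R (w - u)"
  have t: "0 < t" "t \<le> 1" using False assms by (auto simp: t_def)
  have "norm ((1 / t) *\<^sub>R (w - u)) = R" using False assms by (auto simp: t_def)
  then have z: "norm z \<le> 2 * R" unfolding z_def by (smt (verit) norm_triangle_ineq assms(4))
  have u2: "norm u \<le> 2 * R" using assms by linarith
  have "(1 - t) *\<^sub>R u + t *\<^sub>R z = w"
    unfolding z_def using t by (simp add: algebra_simps)
  moreover have "f ((1 - t) *\<^sub>R u + t *\<^sub>R z) \<le> (1 - t) * f u + t * f z"
    using t z u2 assms(2) by (intro convex_onD[OF assms(1)]) auto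
  ultimately have "f w - f u \<le> t * (f z - f u)" by (simp add: algebra_simps)
  also have "\<dots> \<le> t * C" using bd[OF z] bd[OF u2] t by (intro mult_left_mono) auto
  finally show ?thesis by (simp add: t_def mult.commute)
qed simp

text \<open>Truncation costs at most a multiple of \<open>norm (subvec J1 u)\<close>, by the
  Lipschitz bound on \<open>D n\<close> and the bound on s, and gains a diverging multiple of the
  sum T of powers. On a ball \<open>\<bar>x\<bar>\<close> is at most
  \<open>R powr (1 - \<gamma>) * \<bar>x\<bar> powr \<gamma>\<close>, so cost and gain can both be
  measured by T.\<close>

lemma sparse:
  assumes R: "R > 0"
  shows "eventually (\<lambda>n. \<forall>s u. norm s \<le> S \<longrightarrow> norm u \<le> R \<longrightarrow> V n s u \<le> V n s (subvec J2 u)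
    \<longrightarrow> subvec J1 u = 0) sequentially"
proof -
  \<comment> \<open>An upper bound for \<open>D n\<close> on the ball of radius
    \<open>2 * R\<close>: the bound on the limiting form, with 1 added for the approximation
    error.\<close>
  define C where "C = CARD('p) * norm J * (2 * R)\<^sup>2 + 1"
  \<comment> \<open>The cost of truncation per unit of T: the Lipschitz constant of the smooth part
    times the comparison factor between absolute values and powers.\<close>
  define L where "L = (\<bar>S\<bar> + C / R) * R powr (1 - \<gamma>)"
  have "filterlim (\<lambda>n. lam * real n powr ((\<gamma>\<^sub>0 - \<gamma>) / 2)) at_top sequentially"
    using \<gamma> lam by real_asymp
  then have "eventually (\<lambda>n. L < lam * real n powr ((\<gamma>\<^sub>0 - \<gamma>) / 2)) sequentially"
    by (rule filterlim_at_top_dense[THEN iffD1, rule_format])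
  moreover have "eventually (\<lambda>n. \<forall>u. norm u \<le> 2 * R \<longrightarrow> \<bar>D n u - u \<bullet> (J *v u) / 2\<bar> \<le> 1) sequentially"
    by (rule D_limit) simp
  ultimately show ?thesis
    using eventually_ge_at_top[of 1] eventually_cball_local_domain[of "2 * R"]
  proof eventually_elim
    case (elim n)
    have D_bd: "0 \<le> D n z \<and> D n z \<le> C" if "norm z \<le> 2 * R" for z
    proof -
      have "z \<bullet> (J *v z) \<le> CARD('p) * norm J * (norm z)\<^sup>2"
        using abs_quadratic_form_le[of z J] by linarith
      also have "\<dots> \<le> CARD('p) * norm J * (2 * R)\<^sup>2"
        using that by (intro mult_left_mono power_mono) auto
      finally have "z \<bullet> (J *v z) \<le> C - 1" by (simp add: C_def)
      moreover have "C \<ge> 1" by (simp add: C_def)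
      moreover have "\<bar>D n z - z \<bullet> (J *v z) / 2\<bar> \<le> 1" using elim(2) that by simp
      moreover have "0 \<le> D n z" using D_nonneg[OF elim(3)] elim(4) that by (auto simp: local_domain_def)
      ultimately show ?thesis by linarith
    qed
    have "C \<ge> 0" by (simp add: C_def)
    show ?case
    proof (intro allI impI)
      fix s u :: "real^'p" assume s: "norm s \<le> S" and u: "norm u \<le> R" and V: "V n s u \<le> V n s (subvec J2 u)"
      define T where "T = (\<Sum>j\<in>J1. \<bar>u $ j\<bar> powr \<gamma>)"
      have "T \<ge> 0" unfolding T_def by (intro sum_nonneg) auto
      have diff: "u - subvec J2 u = subvec J1 u" using split_subvec[of u] by (simp add: algebra_simps)
      have n1: "norm (subvec J1 u) \<le> R powr (1 - \<gamma>) * T"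
      proof -
        have "norm (subvec J1 u) \<le> (\<Sum>j\<in>UNIV. \<bar>subvec J1 u $ j\<bar>)" by (rule norm_le_l1_cart)
        also have "\<dots> = (\<Sum>j\<in>J1. \<bar>u $ j\<bar>)"
          by (rule sum.mono_neutral_cong_right) (auto simp: subvec_def)
        also have "\<dots> \<le> (\<Sum>j\<in>J1. R powr (1 - \<gamma>) * \<bar>u $ j\<bar> powr \<gamma>)"
        proof (rule sum_mono)
          fix j
          have "\<bar>u $ j\<bar> powr (1 - \<gamma>) \<le> R powr (1 - \<gamma>)"
            using component_le_norm_cart[of u j] u \<gamma> by (intro powr_mono2) auto
          then have "\<bar>u $ j\<bar> powr (1 - \<gamma>) * \<bar>u $ j\<bar> powr \<gamma> \<le> R powr (1 - \<gamma>) * \<bar>u $ j\<bar> powr \<gamma>"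
            by (intro mult_right_mono) auto
          moreover have "\<bar>u $ j\<bar> powr (1 - \<gamma>) * \<bar>u $ j\<bar> powr \<gamma> = \<bar>u $ j\<bar>"
            by (simp add: powr_add[symmetric])
          ultimately show "\<bar>u $ j\<bar> \<le> R powr (1 - \<gamma>) * \<bar>u $ j\<bar> powr \<gamma>" by simp
        qed
        finally show ?thesis by (simp add: T_def sum_distrib_left)
      qed
      have "D n (subvec J2 u) - D n u \<le> C / R * norm (subvec J2 u - u)"
      proof (rule convex_on_diff_le[OF D_convex[OF elim(3)] _ R u _ D_bd])
        have "norm (subvec J1 u) \<le> R" using norm_subvec_le[of J1 u] u by linarith
        then show "norm (subvec J2 u - u) \<le> R" by (metis diff norm_minus_commute)
      qed (use elim(4) in \<open>auto simp: local_domain_def\<close>)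
      moreover have "norm (subvec J2 u - u) = norm (subvec J1 u)" by (metis diff norm_minus_commute)
      moreover have "s \<bullet> u - s \<bullet> subvec J2 u \<le> \<bar>S\<bar> * norm (subvec J1 u)"
      proof -
        have "s \<bullet> u - s \<bullet> subvec J2 u = s \<bullet> subvec J1 u" by (simp add: diff[symmetric] inner_diff_right)
        also have "\<dots> \<le> norm s * norm (subvec J1 u)" by (rule norm_cauchy_schwarz)
        also have "\<dots> \<le> \<bar>S\<bar> * norm (subvec J1 u)" using s by (intro mult_right_mono) auto
        finally show ?thesis .
      qed
      moreover have "lam * (pen n u - pen n (subvec J2 u)) = lam * real n powr ((\<gamma>\<^sub>0 - \<gamma>) / 2) * T"
        by (simp add: pen_J1[OF elim(3)] T_def)
      ultimately have "lam * real n powr ((\<gamma>\<^sub>0 - \<gamma>) / 2) * T \<le> (\<bar>S\<bar> + C / R) * norm (subvec J1 u)"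
        using V unfolding V_def by (simp add: algebra_simps)
      also have "\<dots> \<le> (\<bar>S\<bar> + C / R) * (R powr (1 - \<gamma>) * T)"
        using \<open>C \<ge> 0\<close> R by (intro mult_left_mono n1) auto
      also have "\<dots> = L * T" by (simp add: L_def)
      finally have "(lam * real n powr ((\<gamma>\<^sub>0 - \<gamma>) / 2) - L) * T \<le> 0" by (simp add: algebra_simps)
      then have "T \<le> 0" using elim(1) by (simp add: mult_le_0_iff)
      then have "norm (subvec J1 u) \<le> 0" using n1 \<open>T \<ge> 0\<close> by simp
      then show "subvec J1 u = 0" by simp
    qed
  qed
qed

section \<open>Limit of the nonzero coordinates\<close>

lemma abs_powr_has_derivative:
  assumes "x \<noteq> 0"
  shows "((\<lambda>x. \<bar>x\<bar> powr \<gamma>) has_real_derivative \<gamma> * sgn x * \<bar>x\<bar> powr (\<gamma> - 1)) (at x)"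
proof (cases "x > 0")
  case True
  have "((\<lambda>x. x powr \<gamma>) has_real_derivative \<gamma> * x powr (\<gamma> - 1)) (at x)"
    using True by (rule has_real_derivative_powr)
  then have "((\<lambda>x. \<bar>x\<bar> powr \<gamma>) has_real_derivative \<gamma> * x powr (\<gamma> - 1)) (at x)"
    by (rule has_field_derivative_transform_within_open[of _ _ _ "{0<..}"]) (use True in auto)
  then show ?thesis using True by simp
next
  case False
  then have x: "x < 0" using assms by simp
  have "((\<lambda>x. (- x) powr \<gamma>) has_real_derivative - (\<gamma> * (- x) powr (\<gamma> - 1))) (at x)"
    using x by (auto intro!: derivative_eq_intros)
  then have "((\<lambda>x. \<bar>x\<bar> powr \<gamma>) has_real_derivative - (\<gamma> * (- x) powr (\<gamma> - 1))) (at x)"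
    by (rule has_field_derivative_transform_within_open[of _ _ _ "{..<0}"]) (use x in auto)
  then show ?thesis using x by simp
qed

text \<open>Away from 0 the power is differentiable, so its increment over the step
  \<open>u $ j / sqrt n\<close> is linear up to a small multiple of that step. For j outside
  \<open>J2\<close> the hypothesis on u makes the coordinate zero and both terms vanish.\<close>

lemma pen_component_limit:
  assumes "\<epsilon> > 0"
  shows "eventually (\<lambda>n. \<forall>u. norm u \<le> R \<longrightarrow> subvec J2 u = u \<longrightarrow>
    \<bar>real n powr (\<gamma>\<^sub>0 / 2) * (\<bar>(\<beta>\<^sub>0 + (1 / sqrt (real n)) *\<^sub>R u) $ j\<bar> powr \<gamma> - \<bar>\<beta>\<^sub>0 $ j\<bar> powr \<gamma>)
      - (if \<gamma>\<^sub>0 = 1 then \<eta> $ j * u $ j else 0)\<bar> \<le> \<epsilon>) sequentially"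
proof (cases "j \<in> J2")
  case False
  have "u $ j = 0" if "subvec J2 u = u" for u
  proof -
    have "u $ j = subvec J2 u $ j" using that by simp
    then show ?thesis using False by (simp add: subvec_def)
  qed
  then show ?thesis using assms by (intro always_eventually) simp
next
  case True
  define c0 :: real where "c0 = (if \<gamma>\<^sub>0 = 1 then 1 else 0)"
  \<comment> \<open>The normalization splits as \<open>a n * sqrt (real n)\<close>: the root turns a
    difference into a difference quotient, and \<open>a n\<close> tends to \<open>c0\<close>, the
    indicator of \<open>\<gamma>\<^sub>0 = 1\<close>.\<close>
  define a where "a n = real n powr ((\<gamma>\<^sub>0 - 1) / 2)" for n
  define B where "B = \<bar>R\<bar> + 1"
  define e where "e = \<epsilon> / (2 * B)"
  have "B > 0" by (simp add: B_def)
  then have e: "e > 0" "e * B = \<epsilon> / 2"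
    using assms by (auto simp: e_def)
  have "((\<lambda>x. \<bar>x\<bar> powr \<gamma>) has_derivative (*) (\<eta> $ j)) (at (\<beta>\<^sub>0 $ j))"
    using abs_powr_has_derivative[of "\<beta>\<^sub>0 $ j"] True
    by (simp add: has_field_derivative_def \<eta>_def J2_def)
  \<comment> \<open>A single d serves all u at once, since every displacement is at most
    \<open>B / sqrt n\<close>.\<close>
  then obtain d where d: "d > 0" "\<And>x. \<bar>x - \<beta>\<^sub>0 $ j\<bar> < d \<Longrightarrow>
      \<bar>\<bar>x\<bar> powr \<gamma> - \<bar>\<beta>\<^sub>0 $ j\<bar> powr \<gamma> - \<eta> $ j * (x - \<beta>\<^sub>0 $ j)\<bar> \<le> e * \<bar>x - \<beta>\<^sub>0 $ j\<bar>"
    unfolding has_derivative_at_alt using e(1) by (metis real_norm_def)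
  have "a \<longlonglongrightarrow> c0"
  proof (cases "\<gamma>\<^sub>0 = 1")
    case True
    have "eventually (\<lambda>n. a n = 1) sequentially"
      using eventually_ge_at_top[of 1] by eventually_elim (simp add: a_def True)
    then show ?thesis using True by (simp add: c0_def tendsto_eventually)
  next
    case False
    then have "\<gamma>\<^sub>0 < 1" using \<gamma> by simp
    then have "(\<lambda>n. real n powr ((\<gamma>\<^sub>0 - 1) / 2)) \<longlonglongrightarrow> 0" by real_asymp
    then show ?thesis using False by (simp add: c0_def a_def[abs_def])
  qed
  then have "(\<lambda>n. \<bar>a n - c0\<bar> * (\<bar>\<eta> $ j\<bar> * B)) \<longlonglongrightarrow> \<bar>c0 - c0\<bar> * (\<bar>\<eta> $ j\<bar> * B)" by (intro tendsto_intros)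
  then have "eventually (\<lambda>n. \<bar>a n - c0\<bar> * (\<bar>\<eta> $ j\<bar> * B) < \<epsilon> / 2) sequentially"
    using assms by (intro order_tendstoD(2)) auto
  moreover have "(\<lambda>n. 1 / sqrt (real n) * B) \<longlonglongrightarrow> 0" by real_asymp
  then have "eventually (\<lambda>n. 1 / sqrt (real n) * B < d) sequentially"
    using d(1) order_tendstoD(2) by blast
  ultimately show ?thesis using eventually_ge_at_top[of 1]
  proof eventually_elim
    case (elim n)
    have a1: "a n \<le> 1" "0 \<le> a n"
      unfolding a_def using elim(3) \<gamma> powr_mono[of "(\<gamma>\<^sub>0 - 1) / 2" 0 "real n"] by auto
    show ?case
    proof (intro allI impI)
      fix u :: "real^'p" assume u: "norm u \<le> R" "subvec J2 u = u"
      define q where "q = sqrt (real n) * (\<bar>(\<beta>\<^sub>0 + (1 / sqrt (real n)) *\<^sub>R u) $ j\<bar> powr \<gamma> - \<bar>\<beta>\<^sub>0 $ j\<bar> powr \<gamma>)"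
      have uj: "\<bar>u $ j\<bar> \<le> B" using component_le_norm_cart[of u j] u(1) by (simp add: B_def)
      have "\<bar>1 / sqrt (real n) * u $ j\<bar> \<le> 1 / sqrt (real n) * B"
        unfolding abs_mult using uj by (intro mult_mono) auto
      then have "\<bar>(\<beta>\<^sub>0 + (1 / sqrt (real n)) *\<^sub>R u) $ j - \<beta>\<^sub>0 $ j\<bar> < d" using elim(2) by simp
      note d(2)[OF this]
      then have "sqrt (real n) * \<bar>\<bar>(\<beta>\<^sub>0 + (1 / sqrt (real n)) *\<^sub>R u) $ j\<bar> powr \<gamma> - \<bar>\<beta>\<^sub>0 $ j\<bar> powr \<gamma>
           - \<eta> $ j * (1 / sqrt (real n) * u $ j)\<bar> \<le> sqrt (real n) * (e * \<bar>1 / sqrt (real n) * u $ j\<bar>)"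
        by (intro mult_left_mono) auto
      also have "\<dots> = e * \<bar>u $ j\<bar>" using elim(3) by (simp add: abs_mult)
      also have "\<dots> \<le> e * B" using e(1) uj by (intro mult_left_mono) auto
      also have "sqrt (real n) * \<bar>\<bar>(\<beta>\<^sub>0 + (1 / sqrt (real n)) *\<^sub>R u) $ j\<bar> powr \<gamma> - \<bar>\<beta>\<^sub>0 $ j\<bar> powr \<gamma>
           - \<eta> $ j * (1 / sqrt (real n) * u $ j)\<bar> = \<bar>sqrt (real n) * (\<bar>(\<beta>\<^sub>0 + (1 / sqrt (real n)) *\<^sub>R u) $ j\<bar> powr \<gamma> - \<bar>\<beta>\<^sub>0 $ j\<bar> powr \<gamma>
           - \<eta> $ j * (1 / sqrt (real n) * u $ j))\<bar>" by (simp add: abs_mult)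
      also have "sqrt (real n) * (\<bar>(\<beta>\<^sub>0 + (1 / sqrt (real n)) *\<^sub>R u) $ j\<bar> powr \<gamma> - \<bar>\<beta>\<^sub>0 $ j\<bar> powr \<gamma>
           - \<eta> $ j * (1 / sqrt (real n) * u $ j)) = q - \<eta> $ j * u $ j"
        using elim(3) by (simp add: q_def right_diff_distrib)
      finally have q: "\<bar>q - \<eta> $ j * u $ j\<bar> \<le> \<epsilon> / 2" using e(2) by simp
      have "real n powr (\<gamma>\<^sub>0 / 2) = a n * sqrt (real n)"
        by (simp add: a_def powr_half_sqrt[symmetric] powr_add[symmetric] diff_divide_distrib)
      \<comment> \<open>Splits the deviation into the error of the linearization, damped by
        \<open>a n \<le> 1\<close>, and the error of replacing \<open>a n\<close> by its limit; each
        is at most half of \<epsilon>.\<close>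
      then have "\<bar>real n powr (\<gamma>\<^sub>0 / 2) * (\<bar>(\<beta>\<^sub>0 + (1 / sqrt (real n)) *\<^sub>R u) $ j\<bar> powr \<gamma> - \<bar>\<beta>\<^sub>0 $ j\<bar> powr \<gamma>)
          - (if \<gamma>\<^sub>0 = 1 then \<eta> $ j * u $ j else 0)\<bar> = \<bar>a n * (q - \<eta> $ j * u $ j) + (a n - c0) * (\<eta> $ j * u $ j)\<bar>"
        by (simp add: q_def c0_def algebra_simps)
      also have "\<dots> \<le> \<bar>a n * (q - \<eta> $ j * u $ j)\<bar> + \<bar>(a n - c0) * (\<eta> $ j * u $ j)\<bar>"
        by (rule abs_triangle_ineq)
      also have "\<bar>a n * (q - \<eta> $ j * u $ j)\<bar> \<le> 1 * (\<epsilon> / 2)"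
        unfolding abs_mult using a1 q by (intro mult_mono) auto
      also have "\<bar>(a n - c0) * (\<eta> $ j * u $ j)\<bar> \<le> \<bar>a n - c0\<bar> * (\<bar>\<eta> $ j\<bar> * B)"
        unfolding abs_mult using uj by (intro mult_left_mono) auto
      finally show "\<bar>real n powr (\<gamma>\<^sub>0 / 2) * (\<bar>(\<beta>\<^sub>0 + (1 / sqrt (real n)) *\<^sub>R u) $ j\<bar> powr \<gamma> - \<bar>\<beta>\<^sub>0 $ j\<bar> powr \<gamma>)
          - (if \<gamma>\<^sub>0 = 1 then \<eta> $ j * u $ j else 0)\<bar> \<le> \<epsilon>"
        using elim(1) by linarith
    qed
  qed
qed

lemma pen_J2_limit:
  assumes "\<epsilon> > 0"
  shows "eventually (\<lambda>n. \<forall>u. norm u \<le> R \<longrightarrow> subvec J2 u = u \<longrightarrow>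
    \<bar>lam * pen n u - bias \<bullet> u\<bar> \<le> \<epsilon>) sequentially"
proof -
  define e where "e = \<epsilon> / (lam * CARD('p))"
  have e: "e > 0" using assms lam by (simp add: e_def)
  let ?t = "\<lambda>n u j. real n powr (\<gamma>\<^sub>0 / 2) * (\<bar>(\<beta>\<^sub>0 + (1 / sqrt (real n)) *\<^sub>R u) $ j\<bar> powr \<gamma> - \<bar>\<beta>\<^sub>0 $ j\<bar> powr \<gamma>)
      - (if \<gamma>\<^sub>0 = 1 then \<eta> $ j * u $ j else 0)"
  have "eventually (\<lambda>n. \<forall>j\<in>(UNIV::'p set). \<forall>u. norm u \<le> R \<longrightarrow> subvec J2 u = u \<longrightarrow> \<bar>?t n u j\<bar> \<le> e) sequentially"
    by (rule eventually_ball_finite) (use pen_component_limit[OF e] in auto)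
  then show ?thesis
  proof eventually_elim
    case (elim n)
    show ?case
    proof (intro allI impI)
      fix u :: "real^'p" assume u: "norm u \<le> R" "subvec J2 u = u"
      have "bias \<bullet> u = lam * (\<Sum>j\<in>UNIV. if \<gamma>\<^sub>0 = 1 then \<eta> $ j * u $ j else 0)"
        by (simp add: bias_def inner_vec_def sum_distrib_left mult.assoc)
      then have "lam * pen n u - bias \<bullet> u = lam * (\<Sum>j\<in>UNIV. ?t n u j)"
        unfolding pen_def by (simp only: sum_distrib_left sum_subtractf right_diff_distrib)
      then have "\<bar>lam * pen n u - bias \<bullet> u\<bar> = lam * \<bar>\<Sum>j\<in>UNIV. ?t n u j\<bar>"
        using lam by (simp only: abs_mult abs_of_pos)
      also have "\<dots> \<le> lam * (\<Sum>j\<in>UNIV. \<bar>?t n u j\<bar>)"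
        using lam by (intro mult_left_mono sum_abs) auto
      also have "\<dots> \<le> lam * (\<Sum>j\<in>(UNIV::'p set). e)"
        using lam elim u by (intro mult_left_mono sum_mono) auto
      also have "\<dots> = \<epsilon>" using lam by (simp add: e_def)
      finally show "\<bar>lam * pen n u - bias \<bullet> u\<bar> \<le> \<epsilon>" .
    qed
  qed
qed

lemma subvec_limit: "subvec J2 (limit s) = limit s"
  unfolding limit_def by (rule submat_inv_vec(1)[OF J subvec_idem])

lemma norm_limit_le:
  assumes "norm s \<le> S"
  shows "norm (limit s) \<le> CARD('p) * norm (submat_inv J2 J) * (S + norm bias)"
proof -
  have "norm (limit s) \<le> CARD('p) * norm (submat_inv J2 J) * norm (subvec J2 (s - bias))"
    unfolding limit_def by (rule norm_matrix_vector_mult_le)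
  also have "norm (subvec J2 (s - bias)) \<le> norm (s - bias)" by (rule norm_subvec_le)
  also have "norm (s - bias) \<le> norm s + norm bias" by (rule norm_triangle_ineq4)
  also have "norm s + norm bias \<le> S + norm bias" using assms by simp
  finally show ?thesis by (simp add: mult_left_mono)
qed

text \<open>On vectors supported in \<open>J2\<close> the objective is uniformly close to a strongly
  convex quadratic. A point that does no worse than the quadratic's minimizer is nearly optimal for
  the quadratic, hence close to that minimizer.\<close>

lemma minimizer_near_limit:
  assumes \<epsilon>: "\<epsilon> > 0"
  shows "eventually (\<lambda>n. \<forall>s u. norm s \<le> S \<longrightarrow> norm u \<le> R \<longrightarrow> subvec J2 u = u \<longrightarrow>
    V n s u \<le> V n s (limit s) \<longrightarrow> norm (u - limit s) \<le> \<epsilon>) sequentially"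
proof -
  obtain c where c: "c > 0" "\<And>u. c * (norm u)\<^sup>2 \<le> u \<bullet> (J *v u)"
    using pos_def_lower_bound[OF J] by blast
  \<comment> \<open>Convex part and penalty each err by \<delta> at each of the two points, so the
    quadratic values differ by at most \<open>4 * \<delta>\<close>. The squared J-distance is at
    most twice that, and \<open>8 * \<delta> = c * \<epsilon>\<^sup>2\<close>.\<close>
  define \<delta> where "\<delta> = c * \<epsilon>\<^sup>2 / 8"
  have \<delta>: "\<delta> > 0" using c \<epsilon> by (simp add: \<delta>_def)
  \<comment> \<open>A radius containing both u and \<open>limit s\<close>, so that one uniform
    approximation covers both.\<close>
  define L where "L = max R (CARD('p) * norm (submat_inv J2 J) * (S + norm bias))"
  from D_limit[OF \<delta>, of L] pen_J2_limit[OF \<delta>, of L] show ?thesis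
  proof eventually_elim
    case (elim n)
    show ?case
    proof (intro allI impI)
      fix s u :: "real^'p"
      assume s: "norm s \<le> S" and u: "norm u \<le> R" "subvec J2 u = u" and V: "V n s u \<le> V n s (limit s)"
      let ?l = "limit s"
      define w where "w = subvec J2 (s - bias)"
      have near: "\<bar>V n s v - (v \<bullet> (J *v v) / 2 - v \<bullet> w)\<bar> \<le> 2 * \<delta>" if "norm v \<le> L" "subvec J2 v = v" for v
      proof -
        have "v \<bullet> w = subvec J2 v \<bullet> (s - bias)" by (simp add: w_def subvec_inner)
        also have "\<dots> = s \<bullet> v - bias \<bullet> v" by (simp add: that(2) inner_diff_right inner_commute)
        finally have "v \<bullet> w = s \<bullet> v - bias \<bullet> v" .
        moreover have "\<bar>D n v - v \<bullet> (J *v v) / 2\<bar> \<le> \<delta>" "\<bar>lam * pen n v - bias \<bullet> v\<bar> \<le> \<delta>"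
          using elim that by auto
        ultimately show ?thesis unfolding V_def by linarith
      qed
      have "norm ?l \<le> L" using norm_limit_le[OF s] by (simp add: L_def)
      note near[OF this subvec_limit] near[of u]
      moreover have "norm u \<le> L" using u by (simp add: L_def)
      ultimately have W: "u \<bullet> (J *v u) / 2 - u \<bullet> w \<le> ?l \<bullet> (J *v ?l) / 2 - ?l \<bullet> w + 4 * \<delta>"
        using V u(2) by linarith
      have w: "subvec J2 w = w" by (simp add: w_def subvec_idem)
      have l: "v \<bullet> (J *v ?l) = v \<bullet> w" if "subvec J2 v = v" for v
        unfolding limit_def w_def[symmetric] by (rule submat_inv_vec(2)[OF J w that])
      have sym: "?l \<bullet> (J *v u) = u \<bullet> (J *v ?l)"
        using J by (metis dot_transpose_mult inner_commute pos_def_def)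
      \<comment> \<open>Completing the square: the normal equation replaces \<open>J *v ?l\<close>
        by w against every vector supported in \<open>J2\<close>.\<close>
      have "(u - ?l) \<bullet> (J *v (u - ?l)) = u \<bullet> (J *v u) - 2 * (u \<bullet> w) + ?l \<bullet> w"
        by (simp add: matrix_vector_mult_diff_distrib inner_diff_left inner_diff_right sym l u(2) subvec_limit)
      then have "(u - ?l) \<bullet> (J *v (u - ?l)) \<le> 8 * \<delta>"
        using W by (simp add: l subvec_limit)
      then have "c * (norm (u - ?l))\<^sup>2 \<le> c * \<epsilon>\<^sup>2" using c(2)[of "u - ?l"] by (simp add: \<delta>_def)
      then have "(norm (u - ?l))\<^sup>2 \<le> \<epsilon>\<^sup>2" using c(1) by simp
      then show "norm (u - ?l) \<le> \<epsilon>" using \<epsilon> by (simp add: abs_le_square_iff[symmetric])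
    qed
  qed
qed

text \<open>Both competitors, \<open>subvec J2 u\<close> and \<open>limit s\<close>, lie in a ball
  fixed by S and are thus eventually admissible. Comparison with the former gives the zeros, after
  which u is supported in \<open>J2\<close> and comparison with the latter applies.\<close>

theorem minimizer_limit:
  assumes "\<epsilon> > 0"
  shows "eventually (\<lambda>n. \<forall>s. norm s \<le> S \<longrightarrow> (\<exists>u. is_minimizer n s u) \<and>
    (\<forall>u. is_minimizer n s u \<longrightarrow> subvec J1 u = 0 \<and> norm (u - limit s) \<le> \<epsilon>)) sequentially"
proof -
  obtain R where R: "R > 0" "eventually (\<lambda>n. \<forall>s. norm s \<le> S \<longrightarrow>
       (\<exists>u. is_minimizer n s u) \<and> (\<forall>u. is_minimizer n s u \<longrightarrow> norm u \<le> R)) sequentially"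
    using minimizer_exists_bounded .
  define L where "L = max R (CARD('p) * norm (submat_inv J2 J) * (S + norm bias))"
  from R(2) sparse[OF R(1), of S] minimizer_near_limit[OF assms, of S R] eventually_cball_local_domain[of L]
  show ?thesis
  proof eventually_elim
    case (elim n)
    show ?case
    proof (intro allI impI conjI)
      fix s :: "real^'p" assume s: "norm s \<le> S"
      then show "\<exists>u. is_minimizer n s u" using elim(1) by blast
      fix u assume u: "is_minimizer n s u"
      then have uR: "norm u \<le> R" using elim(1) s by blast
      have "norm (subvec J2 u) \<le> L" using norm_subvec_le[of J2 u] uR by (simp add: L_def)
      then have "subvec J2 u \<in> local_domain n" using elim(4) by auto
      then show 1: "subvec J1 u = 0" using u elim(2) s uR by (auto simp: is_minimizer_def)
      then have "subvec J2 u = u" using split_subvec[of u] by simp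
      moreover have "norm (limit s) \<le> L" using norm_limit_le[OF s] by (simp add: L_def)
      then have "limit s \<in> local_domain n" using elim(4) by auto
      ultimately show "norm (u - limit s) \<le> \<epsilon>" using u elim(3) s uR by (auto simp: is_minimizer_def)
    qed
  qed
qed

end

section \<open>Exponential moments and the cumulant function\<close>

text \<open>Some coordinate is at least the norm over the dimension in absolute value, and one of
  its two signed exponentials dominates. Finitely many shifts of the parameter along the axes
  therefore control an exponential of the norm.\<close>

lemma exp_norm_le_sum_Basis:
  fixes v :: "'a::euclidean_space"
  assumes "0 \<le> e"
  shows "exp (e / DIM('a) * norm v) \<le> (\<Sum>i\<in>Basis. exp (v \<bullet> (e *\<^sub>R i)) + exp (v \<bullet> (- (e *\<^sub>R i))))"
proof -
  have "\<exists>i\<in>Basis. norm v / DIM('a) \<le> \<bar>v \<bullet> i\<bar>"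
  proof (rule ccontr)
    assume "\<not> ?thesis"
    then have "(\<Sum>i\<in>Basis. \<bar>v \<bullet> i\<bar>) < (\<Sum>i\<in>(Basis::'a set). norm v / DIM('a))"
      by (intro sum_strict_mono) auto
    then show False
      using norm_le_l1[of v] by simp
  qed
  then obtain i where i: "i \<in> Basis" "norm v / DIM('a) \<le> \<bar>v \<bullet> i\<bar>" by blast
  have "exp (e / DIM('a) * norm v) \<le> exp (e * \<bar>v \<bullet> i\<bar>)"
    using mult_left_mono[OF i(2) assms] by simp
  also have "\<dots> \<le> exp (v \<bullet> (e *\<^sub>R i)) + exp (v \<bullet> (- (e *\<^sub>R i)))"
    by (cases "v \<bullet> i \<ge> 0") (auto simp: add_increasing add_increasing2)
  also have "\<dots> \<le> (\<Sum>i\<in>Basis. exp (v \<bullet> (e *\<^sub>R i)) + exp (v \<bullet> (- (e *\<^sub>R i))))"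
    by (rule member_le_sum[OF i(1)]) (auto intro: add_nonneg_nonneg)
  finally show ?thesis .
qed

lemma power_le_exp_mult:
  fixes x t :: real
  assumes "0 < t"
  shows "\<exists>C>0. \<forall>x\<ge>0. (1 + x) ^ k \<le> C * exp (t * x)"
proof -
  \<comment> \<open>Chosen so that the k-th power of \<open>exp (s * x)\<close> stays below
    \<open>exp (t * x)\<close>; the denominator \<open>real k + 1\<close> also covers
    \<open>k = 0\<close>.\<close>
  define s where "s = t / (real k + 1)"
  have s: "0 < s" "real k * s \<le> t"
    using assms by (auto simp: s_def field_simps)
  have "(1 + x) ^ k \<le> (1 + 1 / s) ^ k * exp (t * x)" if "0 \<le> x" for x
  proof -
    have "1 + x \<le> (1 + 1 / s) * (1 + s * x)"
      using s that by (simp add: field_simps)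
    also have "\<dots> \<le> (1 + 1 / s) * exp (s * x)"
      using s by (intro mult_left_mono exp_ge_add_one_self) auto
    finally have "(1 + x) ^ k \<le> ((1 + 1 / s) * exp (s * x)) ^ k"
      using that by (intro power_mono) auto
    also have "\<dots> = (1 + 1 / s) ^ k * exp (real k * s * x)"
      by (simp add: power_mult_distrib exp_of_nat_mult[symmetric] mult.assoc)
    also have "\<dots> \<le> (1 + 1 / s) ^ k * exp (t * x)"
      using s that by (intro mult_left_mono) (auto intro: mult_right_mono)
    finally show ?thesis .
  qed
  moreover have "(1 + 1 / s) ^ k > 0" using s by (simp add: add_pos_pos)
  ultimately show ?thesis by blast
qed

lemma abs_exp_minus_linear_le:
  fixes x :: real
  shows "\<bar>exp x - 1 - x\<bar> \<le> x\<^sup>2 * exp \<bar>x\<bar>"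
proof -
  obtain t where t: "\<bar>t\<bar> \<le> \<bar>x\<bar>" "exp x = (\<Sum>m<2. x ^ m / fact m) + exp t / fact 2 * x ^ 2"
    using Maclaurin_exp_le[of x 2] by blast
  have "exp t \<le> exp \<bar>x\<bar>" using t(1) by simp
  then have "exp t * x\<^sup>2 \<le> exp \<bar>x\<bar> * x\<^sup>2" by (rule mult_right_mono) simp
  moreover have "exp x - 1 - x = exp t * x\<^sup>2 / 2" using t(2) by (simp add: numeral_2_eq_2)
  moreover have "0 \<le> exp t * x\<^sup>2" by simp
  ultimately show ?thesis by (simp only: mult.commute[of "x\<^sup>2"])
qed

locale exp_family =
  fixes \<nu> :: "(real^'r) measure" and b :: "real^'r \<Rightarrow> real"
  assumes sets_\<nu> [measurable_cong]: "sets \<nu> = sets borel"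
    and b_measurable [measurable]: "b \<in> borel_measurable borel"
begin

abbreviation "\<Theta> \<equiv> interior (natural_parameter_space \<nu> b)"

definition weighted_integral :: "(real^'r \<Rightarrow> real) \<Rightarrow> real^'r \<Rightarrow> real" where
  "weighted_integral \<phi> \<theta> = (\<integral>v. \<phi> v * exp (v \<bullet> \<theta> + b v) \<partial>\<nu>)"

text \<open>A class stable under multiplication by a coordinate, hence under differentiation of the
  weighted integral in the parameter.\<close>

definition poly_growth :: "(real^'r \<Rightarrow> real) \<Rightarrow> bool" where
  "poly_growth \<phi> \<longleftrightarrow> \<phi> \<in> borel_measurable borel \<and> (\<exists>k. \<forall>v. \<bar>\<phi> v\<bar> \<le> (1 + norm v) ^ k)"

lemma poly_growth_one: "poly_growth (\<lambda>_. 1)"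
  unfolding poly_growth_def by (auto intro!: exI[of _ 0])

lemma poly_growth_mult_nth:
  assumes "poly_growth \<phi>"
  shows "poly_growth (\<lambda>v. \<phi> v * v $ j)"
proof -
  obtain k where k: "\<And>v. \<bar>\<phi> v\<bar> \<le> (1 + norm v) ^ k" and [measurable]: "\<phi> \<in> borel_measurable borel"
    using assms by (auto simp: poly_growth_def)
  have "\<bar>\<phi> v * v $ j\<bar> \<le> (1 + norm v) ^ (k + 1)" for v
  proof -
    have "\<bar>\<phi> v\<bar> * \<bar>v $ j\<bar> \<le> (1 + norm v) ^ k * (1 + norm v)"
      using component_le_norm_cart[of v j] by (intro mult_mono k) auto
    then show ?thesis by (simp add: abs_mult mult.commute)
  qed
  then show ?thesis
    unfolding poly_growth_def by (auto intro!: exI[of _ "k + 1"])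
qed

lemma poly_growth_nth: "poly_growth (\<lambda>v. v $ j)"
  using poly_growth_mult_nth[OF poly_growth_one] by simp

lemma integrable_exp_natural_parameter:
  assumes "\<theta> \<in> natural_parameter_space \<nu> b"
  shows "integrable \<nu> (\<lambda>v. exp (v \<bullet> \<theta> + b v))"
  using assms unfolding natural_parameter_space_def
  by (intro integrableI_nonneg) auto

text \<open>At an interior point the parameters shifted by e along each axis, in both directions,
  are still natural; their integrable exponentials add up to a majorant.\<close>

lemma integrable_exp_norm:
  assumes "\<theta> \<in> \<Theta>"
  obtains t where "0 < t" "integrable \<nu> (\<lambda>v. exp (t * norm v) * exp (v \<bullet> \<theta> + b v))"
proof -
  obtain e where e: "0 < e" "cball \<theta> e \<subseteq> natural_parameter_space \<nu> b"
    using assms by (meson mem_interior_cball)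
  have int: "integrable \<nu> (\<lambda>v. exp (v \<bullet> h) * exp (v \<bullet> \<theta> + b v))" if "norm h \<le> e" for h
  proof -
    have "\<theta> + h \<in> natural_parameter_space \<nu> b"
      using e(2) that by (intro subsetD[OF e(2)]) (simp add: dist_norm)
    from integrable_exp_natural_parameter[OF this] show ?thesis
      by (simp add: inner_add_right exp_add[symmetric] algebra_simps)
  qed
  have "integrable \<nu> (\<lambda>v. \<Sum>i\<in>(Basis::(real^'r) set).
      exp (v \<bullet> (e *\<^sub>R i)) * exp (v \<bullet> \<theta> + b v) + exp (v \<bullet> (- (e *\<^sub>R i))) * exp (v \<bullet> \<theta> + b v))"
    using e(1) by (intro Bochner_Integration.integrable_sum Bochner_Integration.integrable_add int)
      simp_all
  then have "integrable \<nu> (\<lambda>v. exp (e / DIM(real^'r) * norm v) * exp (v \<bullet> \<theta> + b v))"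
  proof (rule Bochner_Integration.integrable_bound)
    show "AE v in \<nu>. norm (exp (e / DIM(real^'r) * norm v) * exp (v \<bullet> \<theta> + b v))
      \<le> norm (\<Sum>i\<in>(Basis::(real^'r) set).
        exp (v \<bullet> (e *\<^sub>R i)) * exp (v \<bullet> \<theta> + b v) + exp (v \<bullet> (- (e *\<^sub>R i))) * exp (v \<bullet> \<theta> + b v))"
    proof (rule AE_I2)
      fix v :: "real^'r"
      have "exp (e / DIM(real^'r) * norm v) * exp (v \<bullet> \<theta> + b v)
        \<le> (\<Sum>i\<in>Basis. exp (v \<bullet> (e *\<^sub>R i)) + exp (v \<bullet> (- (e *\<^sub>R i)))) * exp (v \<bullet> \<theta> + b v)"
        using e(1) by (intro mult_right_mono exp_norm_le_sum_Basis) auto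
      then show "norm (exp (e / DIM(real^'r) * norm v) * exp (v \<bullet> \<theta> + b v))
        \<le> norm (\<Sum>i\<in>(Basis::(real^'r) set).
          exp (v \<bullet> (e *\<^sub>R i)) * exp (v \<bullet> \<theta> + b v) + exp (v \<bullet> (- (e *\<^sub>R i))) * exp (v \<bullet> \<theta> + b v))"
        unfolding sum_distrib_right distrib_right real_norm_def
        by (smt (verit, best) abs_of_nonneg exp_ge_zero mult_nonneg_nonneg)
    qed
  qed measurable
  moreover have "0 < e / DIM(real^'r)" using e(1) by simp
  ultimately show ?thesis using that by blast
qed

text \<open>Half of the available exponential rate absorbs the polynomial. The other half remains as
  a weight, with the same t for all k, and later dominates a small change of parameter.\<close>

lemma integrable_poly_exp_norm:
  assumes "\<theta> \<in> \<Theta>"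
  shows "\<exists>t>0. \<forall>k. integrable \<nu> (\<lambda>v. (1 + norm v) ^ k * exp (t * norm v) * exp (v \<bullet> \<theta> + b v))"
proof -
  obtain t where t: "0 < t" "integrable \<nu> (\<lambda>v. exp (t * norm v) * exp (v \<bullet> \<theta> + b v))"
    using integrable_exp_norm[OF assms] .
  have "integrable \<nu> (\<lambda>v. (1 + norm v) ^ k * exp (t / 2 * norm v) * exp (v \<bullet> \<theta> + b v))" for k
  proof -
    obtain C where C: "C > 0" "\<And>x. x \<ge> 0 \<Longrightarrow> (1 + x) ^ k \<le> C * exp (t / 2 * x)"
      using power_le_exp_mult[of "t / 2" k] t(1) by auto
    have "integrable \<nu> (\<lambda>v. C * (exp (t * norm v) * exp (v \<bullet> \<theta> + b v)))"
      using t(2) by simp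
    then show ?thesis
    proof (rule Bochner_Integration.integrable_bound)
      show "AE v in \<nu>. norm ((1 + norm v) ^ k * exp (t / 2 * norm v) * exp (v \<bullet> \<theta> + b v))
        \<le> norm (C * (exp (t * norm v) * exp (v \<bullet> \<theta> + b v)))"
      proof (rule AE_I2)
        fix v :: "real^'r"
        have "(1 + norm v) ^ k * exp (t / 2 * norm v)
            \<le> C * exp (t / 2 * norm v) * exp (t / 2 * norm v)"
          by (intro mult_right_mono C(2)) auto
        also have "\<dots> = C * exp (t * norm v)"
          by (simp add: mult.assoc exp_add[symmetric])
        finally show "norm ((1 + norm v) ^ k * exp (t / 2 * norm v) * exp (v \<bullet> \<theta> + b v))
          \<le> norm (C * (exp (t * norm v) * exp (v \<bullet> \<theta> + b v)))"
          using C(1) by (simp add: abs_mult mult.assoc[symmetric])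
      qed
    qed measurable
  qed
  then show ?thesis using t(1) by (intro exI[of _ "t / 2"]) simp
qed

lemma integrable_poly_growth:
  assumes "\<theta> \<in> \<Theta>" "poly_growth \<phi>"
  shows "integrable \<nu> (\<lambda>v. \<phi> v * exp (v \<bullet> \<theta> + b v))"
proof -
  obtain k where k: "\<And>v. \<bar>\<phi> v\<bar> \<le> (1 + norm v) ^ k" and [measurable]: "\<phi> \<in> borel_measurable borel"
    using assms by (auto simp: poly_growth_def)
  obtain t where t: "0 < t"
    "integrable \<nu> (\<lambda>v. (1 + norm v) ^ k * exp (t * norm v) * exp (v \<bullet> \<theta> + b v))"
    using integrable_poly_exp_norm[OF assms(1)] by blast
  from t(2) show ?thesis
  proof (rule Bochner_Integration.integrable_bound)
    show "AE v in \<nu>. norm (\<phi> v * exp (v \<bullet> \<theta> + b v))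
        \<le> norm ((1 + norm v) ^ k * exp (t * norm v) * exp (v \<bullet> \<theta> + b v))"
    proof (rule AE_I2)
      fix v :: "real^'r"
      have "\<bar>\<phi> v\<bar> * 1 \<le> (1 + norm v) ^ k * exp (t * norm v)"
        using t(1) by (intro mult_mono k) auto
      then show "norm (\<phi> v * exp (v \<bullet> \<theta> + b v))
        \<le> norm ((1 + norm v) ^ k * exp (t * norm v) * exp (v \<bullet> \<theta> + b v))"
        by (simp add: abs_mult)
    qed
  qed measurable
qed

text \<open>Differentiation under the integral by an explicit remainder:
  \<open>exp (v \<bullet> h) - 1 - v \<bullet> h\<close> is at most \<open>(norm h)\<^sup>2\<close>
  times a weight whose product with \<phi> is integrable, so the error is quadratic in h.\<close>

lemma weighted_integral_GDERIV:
  assumes \<theta>: "\<theta> \<in> \<Theta>" and \<phi>: "poly_growth \<phi>"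
  shows "GDERIV (weighted_integral \<phi>) \<theta> :> (\<chi> j. weighted_integral (\<lambda>v. \<phi> v * v $ j) \<theta>)"
    (is "GDERIV _ _ :> ?G")
proof -
  obtain k where k: "\<And>v. \<bar>\<phi> v\<bar> \<le> (1 + norm v) ^ k" and [measurable]: "\<phi> \<in> borel_measurable borel"
    using \<phi> by (auto simp: poly_growth_def)
  \<comment> \<open>The two extra powers dominate the square of \<open>v \<bullet> h\<close>, and
    the exponential weight dominates \<open>exp \<bar>v \<bullet> h\<bar>\<close> as long as
    \<open>norm h < t\<close>.\<close>
  obtain t where t: "0 < t"
    "integrable \<nu> (\<lambda>v. (1 + norm v) ^ (k + 2) * exp (t * norm v) * exp (v \<bullet> \<theta> + b v))"
    using integrable_poly_exp_norm[OF \<theta>] by blast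
  define C where "C = (\<integral>v. (1 + norm v) ^ (k + 2) * exp (t * norm v) * exp (v \<bullet> \<theta> + b v) \<partial>\<nu>)"
  have "C \<ge> 0" unfolding C_def by (intro integral_nonneg_AE AE_I2) auto
  obtain e where e: "0 < e" "ball \<theta> e \<subseteq> \<Theta>"
    using \<theta> by (meson open_interior open_contains_ball)
  have inner_G: "integrable \<nu> (\<lambda>v. \<phi> v * (v \<bullet> h) * exp (v \<bullet> \<theta> + b v)) \<and>
     (\<integral>v. \<phi> v * (v \<bullet> h) * exp (v \<bullet> \<theta> + b v) \<partial>\<nu>) = h \<bullet> ?G" for h :: "real^'r"
  proof -
    have eq: "\<phi> v * (v \<bullet> h) * exp (v \<bullet> \<theta> + b v)
        = (\<Sum>j\<in>UNIV. h $ j * (\<phi> v * v $ j * exp (v \<bullet> \<theta> + b v)))" for v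
      by (simp add: inner_vec_def sum_distrib_left sum_distrib_right mult_ac)
    have int: "integrable \<nu> (\<lambda>v. h $ j * (\<phi> v * v $ j * exp (v \<bullet> \<theta> + b v)))" for j
      using integrable_poly_growth[OF \<theta> poly_growth_mult_nth[OF \<phi>]] by simp
    show ?thesis
      unfolding eq using int
      by (simp add: Bochner_Integration.integral_sum inner_vec_def weighted_integral_def)
  qed
  have rem: "\<bar>weighted_integral \<phi> (\<theta> + h) - weighted_integral \<phi> \<theta> - h \<bullet> ?G\<bar> \<le> C * (norm h)\<^sup>2"
    if h: "norm h < min e t" for h
  proof -
    have "\<theta> + h \<in> \<Theta>" using e(2) h by (intro subsetD[OF e(2)]) (simp add: dist_norm)
    note int = integrable_poly_growth[OF this \<phi>] integrable_poly_growth[OF \<theta> \<phi>]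
      inner_G[of h, THEN conjunct1]
    have eq: "weighted_integral \<phi> (\<theta> + h) - weighted_integral \<phi> \<theta> - h \<bullet> ?G
      = (\<integral>v. \<phi> v * exp (v \<bullet> (\<theta> + h) + b v) - \<phi> v * exp (v \<bullet> \<theta> + b v)
          - \<phi> v * (v \<bullet> h) * exp (v \<bullet> \<theta> + b v) \<partial>\<nu>)" (is "_ = (\<integral>v. ?f v \<partial>\<nu>)")
      using int inner_G[of h] by (simp add: weighted_integral_def)
    have "norm (\<integral>v. ?f v \<partial>\<nu>) \<le>
      (\<integral>v. (norm h)\<^sup>2 * ((1 + norm v) ^ (k + 2) * exp (t * norm v) * exp (v \<bullet> \<theta> + b v)) \<partial>\<nu>)"
    proof (rule Bochner_Integration.integral_norm_bound_integral)
      show "integrable \<nu> ?f" using int by auto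
      show "integrable \<nu> (\<lambda>v. (norm h)\<^sup>2 *
          ((1 + norm v) ^ (k + 2) * exp (t * norm v) * exp (v \<bullet> \<theta> + b v)))"
        using t(2) by simp
      fix v
      have vh: "\<bar>v \<bullet> h\<bar> \<le> norm v * norm h" by (rule Cauchy_Schwarz_ineq2)
      have vh2: "(v \<bullet> h)\<^sup>2 \<le> (norm v * norm h)\<^sup>2"
        using vh by (metis abs_ge_zero power2_abs power_mono)
      have "\<bar>exp (v \<bullet> h) - 1 - v \<bullet> h\<bar> \<le> (v \<bullet> h)\<^sup>2 * exp \<bar>v \<bullet> h\<bar>"
        by (rule abs_exp_minus_linear_le)
      also have "\<dots> \<le> (norm v * norm h)\<^sup>2 * exp (t * norm v)"
      proof (intro mult_mono vh2)
        have "\<bar>v \<bullet> h\<bar> \<le> norm v * t"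
          using vh h mult_left_mono[of "norm h" t "norm v"] by auto
        then show "exp \<bar>v \<bullet> h\<bar> \<le> exp (t * norm v)" by (simp add: mult.commute)
      qed auto
      also have "\<dots> \<le> (norm h)\<^sup>2 * (1 + norm v) ^ 2 * exp (t * norm v)"
        by (intro mult_right_mono) (auto simp: power_mult_distrib mult.commute intro!: mult_left_mono power_mono)
      finally have *: "\<bar>exp (v \<bullet> h) - 1 - v \<bullet> h\<bar> \<le> (norm h)\<^sup>2 * (1 + norm v) ^ 2 * exp (t * norm v)" .
      have "?f v = \<phi> v * (exp (v \<bullet> h) - 1 - v \<bullet> h) * exp (v \<bullet> \<theta> + b v)"
        by (simp add: inner_add_right exp_add algebra_simps)
      then have "norm (?f v) = \<bar>\<phi> v\<bar> * \<bar>exp (v \<bullet> h) - 1 - v \<bullet> h\<bar> * exp (v \<bullet> \<theta> + b v)"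
        by (simp add: abs_mult)
      also have "\<dots> \<le> (1 + norm v) ^ k * ((norm h)\<^sup>2 * (1 + norm v) ^ 2 * exp (t * norm v)) * exp (v \<bullet> \<theta> + b v)"
        by (intro mult_right_mono mult_mono k *) auto
      finally show "norm (?f v) \<le> (norm h)\<^sup>2 * ((1 + norm v) ^ (k + 2) * exp (t * norm v) * exp (v \<bullet> \<theta> + b v))"
        by (simp add: power_add power2_eq_square mult_ac)
    qed
    also have "\<dots> = C * (norm h)\<^sup>2" by (simp add: C_def)
    finally show ?thesis unfolding eq by simp
  qed
  show ?thesis
    unfolding gderiv_def has_derivative_at
  proof (intro conjI)
    show "bounded_linear (\<lambda>h. h \<bullet> ?G)" by (rule bounded_linear_inner_left)
    show "(\<lambda>h. norm (weighted_integral \<phi> (\<theta> + h) - weighted_integral \<phi> \<theta> - h \<bullet> ?G) / norm h) \<midarrow>0\<rightarrow> 0"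
    proof (rule real_tendsto_sandwich)
      show "\<forall>\<^sub>F h in at 0. 0 \<le> norm (weighted_integral \<phi> (\<theta> + h) - weighted_integral \<phi> \<theta> - h \<bullet> ?G) / norm h"
        by simp
      show "\<forall>\<^sub>F h in at 0. norm (weighted_integral \<phi> (\<theta> + h) - weighted_integral \<phi> \<theta> - h \<bullet> ?G) / norm h
          \<le> C * norm h"
        unfolding eventually_at
        using e(1) t(1) rem
        by (intro exI[of _ "min e t"]) (auto simp: divide_simps power2_eq_square mult.assoc)
      show "(\<lambda>h. C * norm h) \<midarrow>0\<rightarrow> 0" by (auto intro!: tendsto_eq_intros)
    qed simp
  qed
qed

section \<open>Moments under the family and derivatives of the cumulant\<close>

text \<open>The expectation of \<phi> under the density with parameter \<theta>, written as a ratio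
  so that the quotient rule applies.\<close>

definition moment :: "(real^'r \<Rightarrow> real) \<Rightarrow> real^'r \<Rightarrow> real" where
  "moment \<phi> \<theta> = weighted_integral \<phi> \<theta> / weighted_integral (\<lambda>_. 1) \<theta>"

lemma weighted_integral_one_pos:
  assumes "\<theta> \<in> \<Theta>"
  shows "0 < weighted_integral (\<lambda>_. 1) \<theta>"
proof -
  have "\<theta> \<in> natural_parameter_space \<nu> b" using assms interior_subset by blast
  then show ?thesis
    unfolding weighted_integral_def natural_parameter_space_def
    by (auto simp: integral_eq_nn_integral enn2real_positive_iff)
qed

lemma weighted_integral_isCont:
  assumes "\<theta> \<in> \<Theta>" "poly_growth \<phi>"
  shows "isCont (weighted_integral \<phi>) \<theta>"
  using weighted_integral_GDERIV[OF assms] by (auto simp: gderiv_def intro: has_derivative_continuous)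

lemma moment_isCont:
  assumes "\<theta> \<in> \<Theta>" "poly_growth \<phi>"
  shows "isCont (moment \<phi>) \<theta>"
  unfolding moment_def
  using weighted_integral_isCont[OF assms] weighted_integral_isCont[OF assms(1) poly_growth_one]
    weighted_integral_one_pos[OF assms(1)]
  by (intro continuous_intros) auto

text \<open>Quotient rule. The j-th component is the covariance of \<phi> with the j-th coordinate;
  for \<phi> itself a coordinate it becomes an entry of the Hessian of the cumulant.\<close>

lemma moment_GDERIV:
  assumes \<theta>: "\<theta> \<in> \<Theta>" and \<phi>: "poly_growth \<phi>"
  shows "GDERIV (moment \<phi>) \<theta> :>
    (\<chi> j. moment (\<lambda>v. \<phi> v * v $ j) \<theta> - moment \<phi> \<theta> * moment (\<lambda>v. v $ j) \<theta>)"
proof -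
  note Z = weighted_integral_one_pos[OF \<theta>]
  have inv: "GDERIV (\<lambda>x. inverse (weighted_integral (\<lambda>_. 1) x)) \<theta> :>
      - (inverse (weighted_integral (\<lambda>_. 1) \<theta>))\<^sup>2 *\<^sub>R (\<chi> j. weighted_integral (\<lambda>v. 1 * v $ j) \<theta>)"
    using Z by (intro GDERIV_inverse weighted_integral_GDERIV \<theta> poly_growth_one) auto
  have "GDERIV (\<lambda>x. weighted_integral \<phi> x * inverse (weighted_integral (\<lambda>_. 1) x)) \<theta> :>
    weighted_integral \<phi> \<theta> *\<^sub>R (- (inverse (weighted_integral (\<lambda>_. 1) \<theta>))\<^sup>2 *\<^sub>R (\<chi> j. weighted_integral (\<lambda>v. 1 * v $ j) \<theta>))
    + inverse (weighted_integral (\<lambda>_. 1) \<theta>) *\<^sub>R (\<chi> j. weighted_integral (\<lambda>v. \<phi> v * v $ j) \<theta>)"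
    by (rule GDERIV_mult[OF weighted_integral_GDERIV[OF \<theta> \<phi>] inv])
  then show ?thesis
    unfolding moment_def divide_inverse
    by (rule GDERIV_subst) (auto simp: vec_eq_iff power2_eq_square algebra_simps)
qed

lemma cumulant_GDERIV:
  assumes "\<theta> \<in> \<Theta>"
  shows "GDERIV (cumulant \<nu> b) \<theta> :> (\<chi> j. moment (\<lambda>v. v $ j) \<theta>)"
proof -
  note Z = weighted_integral_one_pos[OF assms]
  have "cumulant \<nu> b = (\<lambda>\<theta>. ln (weighted_integral (\<lambda>_. 1) \<theta>))"
    by (simp add: fun_eq_iff cumulant_def weighted_integral_def)
  then have "GDERIV (cumulant \<nu> b) \<theta> :> inverse (weighted_integral (\<lambda>_. 1) \<theta>) *\<^sub>R
      (\<chi> j. weighted_integral (\<lambda>v. 1 * v $ j) \<theta>)"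
    using GDERIV_DERIV_compose[OF weighted_integral_GDERIV[OF assms poly_growth_one] DERIV_ln[OF Z]]
    by simp
  then show ?thesis
    by (rule GDERIV_subst) (simp add: vec_eq_iff moment_def divide_inverse mult.commute)
qed

end

lemma gradient_eqI:
  assumes "GDERIV f x :> D"
  shows "gradient f x = D"
  unfolding gradient_def
proof (rule the_equality[where P="\<lambda>D. GDERIV f x :> D", OF assms])
  fix D' assume "GDERIV f x :> D'"
  then have "(\<lambda>h. h \<bullet> D') = (\<lambda>h. h \<bullet> D)"
    using assms unfolding gderiv_def by (rule has_derivative_unique)
  then have "(D' - D) \<bullet> D' = (D' - D) \<bullet> D" by (rule fun_cong)
  then have "(D' - D) \<bullet> (D' - D) = 0" by (simp add: inner_diff_right)
  then show "D' = D" by simp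
qed

context exp_family
begin

lemma cumulant_GDERIV_gradient:
  assumes "\<theta> \<in> \<Theta>"
  shows "GDERIV (cumulant \<nu> b) \<theta> :> gradient (cumulant \<nu> b) \<theta>"
  using cumulant_GDERIV[OF assms] gradient_eqI by metis

lemma gradient_cumulant:
  assumes "\<theta> \<in> \<Theta>"
  shows "gradient (cumulant \<nu> b) \<theta> = (\<chi> j. moment (\<lambda>v. v $ j) \<theta>)"
  using cumulant_GDERIV[OF assms] by (rule gradient_eqI)

lemma gradient_cumulant_has_derivative_explicit:
  assumes "\<theta> \<in> \<Theta>"
  shows "(gradient (cumulant \<nu> b) has_derivative
    (\<lambda>h. \<chi> i. h \<bullet> (\<chi> j. moment (\<lambda>v. v $ i * v $ j) \<theta> - moment (\<lambda>v. v $ i) \<theta> * moment (\<lambda>v. v $ j) \<theta>))) (at \<theta>)"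
proof -
  have "((\<lambda>\<theta>. \<chi> j. moment (\<lambda>v. v $ j) \<theta>) has_derivative
    (\<lambda>h. \<chi> i. h \<bullet> (\<chi> j. moment (\<lambda>v. v $ i * v $ j) \<theta> - moment (\<lambda>v. v $ i) \<theta> * moment (\<lambda>v. v $ j) \<theta>))) (at \<theta>)"
    by (subst has_derivative_componentwise_within)
      (use moment_GDERIV[OF assms poly_growth_nth] in
        \<open>auto simp: Basis_vec_def inner_axis gderiv_def\<close>)
  \<comment> \<open>The gradient is known to be the vector of means only on the interior, so the
    derivative is transferred on this open set.\<close>
  then show ?thesis
    by (rule has_derivative_transform_within_open[of _ _ _ _ \<Theta>])
      (use assms in \<open>auto simp: gradient_cumulant\<close>)
qed

text \<open>A Jacobian matrix represents the derivative only once differentiability is known; the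
  explicit covariance form supplies it.\<close>

lemma gradient_cumulant_has_derivative:
  assumes "\<theta> \<in> \<Theta>"
  shows "(gradient (cumulant \<nu> b) has_derivative (\<lambda>h. hessian (cumulant \<nu> b) \<theta> *v h)) (at \<theta>)"
  unfolding hessian_def
  by (rule jacobian_works[THEN iffD1, OF differentiableI[OF
        gradient_cumulant_has_derivative_explicit[OF assms]]])

lemma hessian_cumulant:
  assumes "\<theta> \<in> \<Theta>"
  shows "hessian (cumulant \<nu> b) \<theta> =
    (\<chi> i j. moment (\<lambda>v. v $ i * v $ j) \<theta> - moment (\<lambda>v. v $ i) \<theta> * moment (\<lambda>v. v $ j) \<theta>)"
proof -
  have "frechet_derivative (gradient (cumulant \<nu> b)) (at \<theta>) =
    (\<lambda>h. \<chi> i. h \<bullet> (\<chi> j. moment (\<lambda>v. v $ i * v $ j) \<theta> - moment (\<lambda>v. v $ i) \<theta> * moment (\<lambda>v. v $ j) \<theta>))"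
    by (rule frechet_derivative_at[OF gradient_cumulant_has_derivative_explicit[OF assms], symmetric])
  then show ?thesis
    by (simp add: hessian_def jacobian_def matrix_def vec_eq_iff inner_axis')
qed

lemma continuous_on_hessian_cumulant: "continuous_on \<Theta> (hessian (cumulant \<nu> b))"
proof -
  have "continuous_on \<Theta> (\<lambda>\<theta>. \<chi> i j. moment (\<lambda>v. v $ i * v $ j) \<theta> - moment (\<lambda>v. v $ i) \<theta> * moment (\<lambda>v. v $ j) \<theta>)"
    by (intro continuous_on_vec_lambda continuous_intros continuous_at_imp_continuous_on ballI
        moment_isCont poly_growth_nth poly_growth_mult_nth)
  then show ?thesis
    by (subst continuous_on_cong[OF refl hessian_cumulant]) auto
qed

end

section \<open>Second-order expansions\<close>

text \<open>One-variable Taylor formula along the segment. The Lagrange form of the remainder serves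
  two purposes: its sign yields convexity, its size the uniform expansion.\<close>

lemma taylor2_line:
  fixes f :: "real^'n \<Rightarrow> real"
  assumes f: "\<And>x. x \<in> U \<Longrightarrow> GDERIV f x :> g x"
    and g: "\<And>x. x \<in> U \<Longrightarrow> (g has_derivative (\<lambda>h. H x *v h)) (at x)"
    and seg: "\<And>t. 0 \<le> t \<Longrightarrow> t \<le> 1 \<Longrightarrow> x + t *\<^sub>R h \<in> U"
  shows "\<exists>t. 0 < t \<and> t < 1 \<and> f (x + h) = f x + h \<bullet> g x + h \<bullet> (H (x + t *\<^sub>R h) *v h) / 2"
proof -
  define diff :: "nat \<Rightarrow> real \<Rightarrow> real" where
    "diff m t = (if m = 0 then f (x + t *\<^sub>R h) else if m = 1 then h \<bullet> g (x + t *\<^sub>R h)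
       else h \<bullet> (H (x + t *\<^sub>R h) *v h))" for m t
  have line: "((\<lambda>t. x + t *\<^sub>R h) has_derivative (\<lambda>s. s *\<^sub>R h)) (at t)" for t
    by (auto intro!: derivative_eq_intros)
  have d0: "(diff 0 has_real_derivative diff 1 t) (at t)" if "0 \<le> t" "t \<le> 1" for t
  proof -
    have "((\<lambda>t. f (x + t *\<^sub>R h)) has_derivative (\<lambda>s. s *\<^sub>R h \<bullet> g (x + t *\<^sub>R h))) (at t)"
      using f[OF seg[OF that]] unfolding gderiv_def by (rule has_derivative_compose[OF line])
    then show ?thesis
      by (simp add: has_field_derivative_def diff_def[abs_def] mult_commute_abs)
  qed
  have d1: "(diff 1 has_real_derivative diff 2 t) (at t)" if "0 \<le> t" "t \<le> 1" for t
  proof -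
    have "((\<lambda>t. h \<bullet> g (x + t *\<^sub>R h)) has_derivative (\<lambda>s. h \<bullet> (H (x + t *\<^sub>R h) *v (s *\<^sub>R h)))) (at t)"
      by (intro has_derivative_inner_right has_derivative_compose[OF line g[OF seg[OF that]]])
    then show ?thesis
      by (simp add: has_field_derivative_def diff_def[abs_def] mult_commute_abs matrix_vector_mult_scaleR)
  qed
  have "\<exists>t. 0 < t \<and> t < 1 \<and> f (x + 1 *\<^sub>R h)
      = (\<Sum>m<2. (diff m 0 / fact m) * (1 - 0)^m) + (diff 2 t / fact 2) * (1 - 0)^2"
  proof (rule Taylor_up[where diff = diff and a = 0])
    show "\<forall>m t. m < 2 \<and> 0 \<le> t \<and> t \<le> 1 \<longrightarrow> (diff m has_real_derivative diff (Suc m) t) (at t)"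
    proof (intro allI impI)
      fix m :: nat and t :: real
      assume *: "m < 2 \<and> 0 \<le> t \<and> t \<le> 1"
      then consider "m = 0" | "m = 1" by linarith
      then show "(diff m has_real_derivative diff (Suc m) t) (at t)"
        using d0[of t] d1[of t] * by cases (auto simp: numeral_2_eq_2)
    qed
  qed (auto simp: diff_def)
  then show ?thesis by (simp add: diff_def numeral_2_eq_2)
qed

text \<open>The Lagrange remainder differs from the form at the base point by the increment of H,
  which is uniformly small near the compact set K.\<close>

lemma uniform_taylor2:
  fixes f :: "real^'n \<Rightarrow> real"
  assumes f: "\<And>x. x \<in> U \<Longrightarrow> GDERIV f x :> g x"
    and g: "\<And>x. x \<in> U \<Longrightarrow> (g has_derivative (\<lambda>h. H x *v h)) (at x)"
    and H: "continuous_on U H" and U: "open U" and K: "compact K" "K \<subseteq> U" and \<epsilon>: "\<epsilon> > 0"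
  shows "\<exists>\<delta>>0. \<forall>x\<in>K. \<forall>h. norm h \<le> \<delta> \<longrightarrow>
    \<bar>f (x + h) - f x - h \<bullet> g x - h \<bullet> (H x *v h) / 2\<bar> \<le> \<epsilon> * (norm h)\<^sup>2"
proof -
  obtain d where d: "d > 0" "(\<Union>x\<in>K. cball x d) \<subseteq> U"
    using compact_subset_open_imp_cball_epsilon_subset[OF K(1) U K(2)] .
  \<comment> \<open>A compact thickening of K inside U, containing every segment from a base point
    to its displaced point.\<close>
  define K' where "K' = {x + y | x y. x \<in> K \<and> y \<in> cball 0 d}"
  have "compact K'" unfolding K'_def by (intro compact_sums K(1) compact_cball)
  moreover have "K' \<subseteq> U" using d(2) by (force simp: K'_def dist_norm)
  ultimately have "uniformly_continuous_on K' H"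
    using compact_uniformly_continuous continuous_on_subset[OF H] by blast
  moreover define e where "e = 2 * \<epsilon> / CARD('n)"
  moreover have "e > 0" using \<epsilon> by (simp add: e_def)
  ultimately obtain r where r: "r > 0" "\<And>x y. x \<in> K' \<Longrightarrow> y \<in> K' \<Longrightarrow> dist y x < r \<Longrightarrow> dist (H y) (H x) < e"
    unfolding uniformly_continuous_on_def by metis
  show ?thesis
  proof (intro exI[of _ "min d (r / 2)"] conjI ballI allI impI)
    show "0 < min d (r / 2)" using d(1) r(1) by simp
    fix x h :: "real^'n" assume x: "x \<in> K" and h: "norm h \<le> min d (r / 2)"
    have seg: "x + t *\<^sub>R h \<in> K'" if "0 \<le> t" "t \<le> 1" for t
    proof -
      have "t * norm h \<le> 1 * norm h" using that by (intro mult_right_mono) auto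
      then have "t *\<^sub>R h \<in> cball 0 d" using h that by simp
      then show ?thesis using x unfolding K'_def by blast
    qed
    obtain t where t: "0 < t" "t < 1" "f (x + h) = f x + h \<bullet> g x + h \<bullet> (H (x + t *\<^sub>R h) *v h) / 2"
      using taylor2_line[of U f g H x h, OF f g] seg \<open>K' \<subseteq> U\<close> by blast
    have "t * norm h \<le> 1 * norm h" using t by (intro mult_right_mono) auto
    then have "dist (x + t *\<^sub>R h) x < r" using h r(1) t by (simp add: dist_norm)
    then have "dist (H (x + t *\<^sub>R h)) (H x) < e" using seg[of 0] seg[of t] t by (intro r(2)) auto
    then have n: "norm (H (x + t *\<^sub>R h) - H x) \<le> e" by (simp add: dist_norm)
    have "f (x + h) - f x - h \<bullet> g x - h \<bullet> (H x *v h) / 2 = (h \<bullet> ((H (x + t *\<^sub>R h) - H x) *v h)) / 2"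
      by (simp add: t(3) matrix_vector_mult_diff_rdistrib inner_diff_right diff_divide_distrib)
    then have "\<bar>f (x + h) - f x - h \<bullet> g x - h \<bullet> (H x *v h) / 2\<bar> = \<bar>h \<bullet> ((H (x + t *\<^sub>R h) - H x) *v h)\<bar> / 2"
      by (simp only: abs_divide)
    also have "\<dots> \<le> (CARD('n) * norm (H (x + t *\<^sub>R h) - H x) * (norm h)\<^sup>2) / 2"
      by (intro divide_right_mono abs_quadratic_form_le) simp
    also have "\<dots> \<le> (CARD('n) * e * (norm h)\<^sup>2) / 2"
      by (intro divide_right_mono mult_right_mono mult_left_mono n) auto
    also have "\<dots> = \<epsilon> * (norm h)\<^sup>2" by (simp add: e_def)
    finally show "\<bar>f (x + h) - f x - h \<bullet> g x - h \<bullet> (H x *v h) / 2\<bar> \<le> \<epsilon> * (norm h)\<^sup>2" .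
  qed
qed

section \<open>The log-likelihood of the generalized linear model\<close>

locale glm = exp_family \<nu> b
  for \<nu> :: "(real^'r) measure" and b :: "real^'r \<Rightarrow> real" +
  fixes \<B> :: "(real^'p) set" and \<beta>\<^sub>0 :: "real^'p" and \<X> :: "(real^'p^'r) set"
    and X :: "nat \<Rightarrow> real^'p^'r" and J :: "real^'p^'p"
  assumes hessian_pos_def: "\<theta> \<in> \<Theta> \<Longrightarrow> pos_def (hessian (cumulant \<nu> b) \<theta>)"
    and open_\<B>: "open \<B>" and convex_\<B>: "convex \<B>" and \<beta>\<^sub>0: "\<beta>\<^sub>0 \<in> \<B>"
    and X: "i \<ge> 1 \<Longrightarrow> X i \<in> \<X>"
    and compact_\<X>: "compact \<X>"
    and linear_predictor: "x \<in> \<X> \<Longrightarrow> \<beta> \<in> \<B> \<Longrightarrow> x *v \<beta> \<in> \<Theta>"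
    and gram_limit: "(\<lambda>n. (1 / real n) *\<^sub>R (\<Sum>i\<in>{1..n}. weighted_gram \<nu> b \<beta>\<^sub>0 (X i))) \<longlonglongrightarrow> J"
    and J: "pos_def J"
begin

abbreviation "a \<equiv> cumulant \<nu> b"
abbreviation "mean \<equiv> gradient a"

text \<open>The Bregman divergence of the cumulant between the linear predictors at
  \<open>\<beta>\<^sub>0 + h\<close> and \<open>\<beta>\<^sub>0\<close>: the part of the negative
  log-likelihood increment left after its linear term.\<close>

definition excess :: "real^'p^'r \<Rightarrow> real^'p \<Rightarrow> real" where
  "excess x h = a (x *v (\<beta>\<^sub>0 + h)) - a (x *v \<beta>\<^sub>0) - (x *v h) \<bullet> mean (x *v \<beta>\<^sub>0)"

definition D :: "nat \<Rightarrow> real^'p \<Rightarrow> real" where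
  "D n u = (\<Sum>i\<in>{1..n}. excess (X i) ((1 / sqrt (real n)) *\<^sub>R u))"

text \<open>Convexity of \<open>\<B>\<close> keeps the segment of linear predictors in the interior
  of the parameter space, where the Lagrange remainder is nonnegative by positive definiteness of
  the Hessian.\<close>

lemma cumulant_ge_tangent:
  assumes x: "x \<in> \<X>" and \<beta>: "\<beta> \<in> \<B>" "\<beta>' \<in> \<B>"
  shows "a (x *v \<beta>) + (x *v (\<beta>' - \<beta>)) \<bullet> mean (x *v \<beta>) \<le> a (x *v \<beta>')"
proof -
  define h where "h = x *v (\<beta>' - \<beta>)"
  have seg: "x *v \<beta> + t *\<^sub>R h \<in> \<Theta>" if "0 \<le> t" "t \<le> 1" for t
  proof -
    have "(1 - t) *\<^sub>R \<beta> + t *\<^sub>R \<beta>' \<in> \<B>" using convex_\<B> \<beta> that by (intro convexD) auto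
    then have "x *v ((1 - t) *\<^sub>R \<beta> + t *\<^sub>R \<beta>') \<in> \<Theta>" by (rule linear_predictor[OF x])
    then show ?thesis
      by (simp add: h_def algebra_simps matrix_vector_right_distrib matrix_vector_mult_diff_distrib
          matrix_vector_mult_scaleR)
  qed
  obtain t where t: "0 < t" "t < 1"
    "a (x *v \<beta> + h) = a (x *v \<beta>) + h \<bullet> mean (x *v \<beta>) + h \<bullet> (hessian a (x *v \<beta> + t *\<^sub>R h) *v h) / 2"
    using taylor2_line[of \<Theta> a mean "hessian a", OF cumulant_GDERIV_gradient
        gradient_cumulant_has_derivative seg] by blast
  have "pos_def (hessian a (x *v \<beta> + t *\<^sub>R h))" using t seg by (intro hessian_pos_def) auto
  \<comment> \<open>The case \<open>h = 0\<close> can occur for distinct parameters, since x need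
    not be injective.\<close>
  then have "0 \<le> h \<bullet> (hessian a (x *v \<beta> + t *\<^sub>R h) *v h)"
    by (cases "h = 0") (auto simp: pos_def_def less_imp_le)
  moreover have "x *v \<beta> + h = x *v \<beta>'" by (simp add: h_def matrix_vector_mult_diff_distrib)
  ultimately show ?thesis using t(3) by (simp add: h_def)
qed

text \<open>The tangent inequality at the intermediate point is averaged over the two endpoints,
  which cancels the linear terms.\<close>

lemma excess_convex:
  assumes x: "x \<in> \<X>" and u: "\<beta>\<^sub>0 + u \<in> \<B>" "\<beta>\<^sub>0 + v \<in> \<B>" and t: "0 \<le> t" "t \<le> 1"
  shows "excess x ((1 - t) *\<^sub>R u + t *\<^sub>R v) \<le> (1 - t) * excess x u + t * excess x v"
proof -
  define w where "w = (1 - t) *\<^sub>R u + t *\<^sub>R v"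
  define m where "m = mean (x *v (\<beta>\<^sub>0 + w))"
  have "(1 - t) *\<^sub>R (\<beta>\<^sub>0 + u) + t *\<^sub>R (\<beta>\<^sub>0 + v) \<in> \<B>" using convex_\<B> u t by (intro convexD) auto
  then have w: "\<beta>\<^sub>0 + w \<in> \<B>" by (simp add: w_def algebra_simps)
  have 1: "a (x *v (\<beta>\<^sub>0 + w)) + (x *v (u - w)) \<bullet> m \<le> a (x *v (\<beta>\<^sub>0 + u))"
    using cumulant_ge_tangent[OF x w u(1)] by (simp add: m_def)
  have 2: "a (x *v (\<beta>\<^sub>0 + w)) + (x *v (v - w)) \<bullet> m \<le> a (x *v (\<beta>\<^sub>0 + v))"
    using cumulant_ge_tangent[OF x w u(2)] by (simp add: m_def)
  have "(1 - t) *\<^sub>R (u - w) + t *\<^sub>R (v - w) = 0" by (simp add: w_def algebra_simps)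
  then have "x *v ((1 - t) *\<^sub>R (u - w) + t *\<^sub>R (v - w)) = 0" by (simp only: matrix_vector_mult_0_right)
  then have 3: "(1 - t) *\<^sub>R (x *v (u - w)) + t *\<^sub>R (x *v (v - w)) = 0"
    by (simp only: matrix_vector_right_distrib matrix_vector_mult_scaleR)
  have "(1 - t) * ((x *v (u - w)) \<bullet> m) + t * ((x *v (v - w)) \<bullet> m)
      = ((1 - t) *\<^sub>R (x *v (u - w)) + t *\<^sub>R (x *v (v - w))) \<bullet> m" by (simp add: inner_add_left)
  also have "\<dots> = 0" unfolding 3 by simp
  finally have 4: "(1 - t) * ((x *v (u - w)) \<bullet> m) + t * ((x *v (v - w)) \<bullet> m) = 0" .
  have "(1 - t) * (a (x *v (\<beta>\<^sub>0 + w)) + (x *v (u - w)) \<bullet> m) + t * (a (x *v (\<beta>\<^sub>0 + w)) + (x *v (v - w)) \<bullet> m)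
     \<le> (1 - t) * a (x *v (\<beta>\<^sub>0 + u)) + t * a (x *v (\<beta>\<^sub>0 + v))"
    using t by (intro add_mono mult_left_mono 1 2) auto
  moreover have "(1 - t) * (a (x *v (\<beta>\<^sub>0 + w)) + (x *v (u - w)) \<bullet> m) + t * (a (x *v (\<beta>\<^sub>0 + w)) + (x *v (v - w)) \<bullet> m)
     = a (x *v (\<beta>\<^sub>0 + w)) + ((1 - t) * ((x *v (u - w)) \<bullet> m) + t * ((x *v (v - w)) \<bullet> m))"
    by (simp add: algebra_simps)
  ultimately have 5: "a (x *v (\<beta>\<^sub>0 + w)) \<le> (1 - t) * a (x *v (\<beta>\<^sub>0 + u)) + t * a (x *v (\<beta>\<^sub>0 + v))"
    using 4 by linarith
  have 6: "(x *v w) \<bullet> mean (x *v \<beta>\<^sub>0) = (1 - t) * ((x *v u) \<bullet> mean (x *v \<beta>\<^sub>0)) + t * ((x *v v) \<bullet> mean (x *v \<beta>\<^sub>0))"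
    unfolding w_def by (simp add: matrix_vector_right_distrib matrix_vector_mult_scaleR inner_add_left)
  show ?thesis
    using 5 6 unfolding excess_def w_def[symmetric] by (simp add: algebra_simps)
qed

lemma D_convex: "convex_on {u. \<beta>\<^sub>0 + (1 / sqrt (real n)) *\<^sub>R u \<in> \<B>} (D n)"
proof (rule convex_onI)
  let ?r = "1 / sqrt (real n)"
  have comb: "?r *\<^sub>R ((1 - t) *\<^sub>R u + t *\<^sub>R v) = (1 - t) *\<^sub>R (?r *\<^sub>R u) + t *\<^sub>R (?r *\<^sub>R v)"
    for t and u v :: "real^'p"
    by (simp add: scaleR_add_right mult.commute)
  fix t :: real and u v :: "real^'p"
  assume t: "0 < t" "t < 1" and u: "u \<in> {u. \<beta>\<^sub>0 + ?r *\<^sub>R u \<in> \<B>}" and v: "v \<in> {u. \<beta>\<^sub>0 + ?r *\<^sub>R u \<in> \<B>}"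
  have "D n ((1 - t) *\<^sub>R u + t *\<^sub>R v)
    \<le> (\<Sum>i\<in>{1..n}. (1 - t) * excess (X i) (?r *\<^sub>R u) + t * excess (X i) (?r *\<^sub>R v))"
    unfolding D_def comb using t u v X by (intro sum_mono excess_convex) auto
  then show "D n ((1 - t) *\<^sub>R u + t *\<^sub>R v) \<le> (1 - t) * D n u + t * D n v"
    by (simp add: D_def sum.distrib sum_distrib_left)
next
  let ?r = "1 / sqrt (real n)"
  show "convex {u. \<beta>\<^sub>0 + ?r *\<^sub>R u \<in> \<B>}"
  proof (rule convexI)
    fix u v :: "real^'p" and s t :: real
    assume "u \<in> {u. \<beta>\<^sub>0 + ?r *\<^sub>R u \<in> \<B>}" "v \<in> {u. \<beta>\<^sub>0 + ?r *\<^sub>R u \<in> \<B>}" and st: "0 \<le> s" "0 \<le> t" "s + t = 1"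
    then have "s *\<^sub>R (\<beta>\<^sub>0 + ?r *\<^sub>R u) + t *\<^sub>R (\<beta>\<^sub>0 + ?r *\<^sub>R v) \<in> \<B>"
      using convex_\<B> by (intro convexD) auto
    moreover have "s *\<^sub>R (\<beta>\<^sub>0 + ?r *\<^sub>R u) + t *\<^sub>R (\<beta>\<^sub>0 + ?r *\<^sub>R v) = (s + t) *\<^sub>R \<beta>\<^sub>0 + ?r *\<^sub>R (s *\<^sub>R u + t *\<^sub>R v)"
      by (simp add: scaleR_add_right scaleR_add_left mult.commute)
    ultimately show "s *\<^sub>R u + t *\<^sub>R v \<in> {u. \<beta>\<^sub>0 + ?r *\<^sub>R u \<in> \<B>}" using st by simp
  qed
qed

lemma D_nonneg:
  assumes "\<beta>\<^sub>0 + (1 / sqrt (real n)) *\<^sub>R u \<in> \<B>"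
  shows "0 \<le> D n u"
  unfolding D_def
proof (rule sum_nonneg)
  fix i assume "i \<in> {1..n}"
  then show "0 \<le> excess (X i) ((1 / sqrt (real n)) *\<^sub>R u)"
    using cumulant_ge_tangent[OF X \<beta>\<^sub>0 assms, of i] by (simp add: excess_def)
qed

text \<open>Compactness of the regressor set bounds both matrices: X acts on parameters in the
  expansion of \<open>D\<close>, its transpose on residuals in the score.\<close>

lemma X_bounded:
  obtains B where "B > 0" "\<And>i u. i \<ge> 1 \<Longrightarrow> norm (X i *v u) \<le> B * norm u"
    "\<And>i v. i \<ge> 1 \<Longrightarrow> norm (transpose (X i) *v v) \<le> B * norm v"
proof -
  have "compact (transpose ` \<X>)"
    unfolding transpose_def
    by (intro compact_continuous_image compact_\<X> continuous_on_vec_lambda continuous_intros)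
  from compact_imp_bounded[OF this] obtain B1 where B1: "\<And>x. x \<in> \<X> \<Longrightarrow> norm (transpose x) \<le> B1"
    unfolding bounded_iff by blast
  from compact_imp_bounded[OF compact_\<X>] obtain B0 where B0: "\<And>x. x \<in> \<X> \<Longrightarrow> norm x \<le> B0"
    unfolding bounded_iff by blast
  define C where "C = real (CARD('r) + CARD('p)) * (\<bar>B0\<bar> + \<bar>B1\<bar>) + 1"
  have "norm (X i *v u) \<le> C * norm u" if "i \<ge> 1" for i u
  proof -
    have "norm (X i *v u) \<le> CARD('r) * norm (X i) * norm u" by (rule norm_matrix_vector_mult_le)
    also have "\<dots> \<le> C * norm u"
    proof (rule mult_right_mono)
      have "CARD('r) * norm (X i) \<le> real (CARD('r) + CARD('p)) * (\<bar>B0\<bar> + \<bar>B1\<bar>)"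
        using B0[OF X[OF that]] by (intro mult_mono) auto
      then show "CARD('r) * norm (X i) \<le> C" by (simp add: C_def)
    qed simp
    finally show ?thesis .
  qed
  moreover have "norm (transpose (X i) *v u) \<le> C * norm u" if "i \<ge> 1" for i u
  proof -
    have "norm (transpose (X i) *v u) \<le> CARD('p) * norm (transpose (X i)) * norm u"
      by (rule norm_matrix_vector_mult_le)
    also have "\<dots> \<le> C * norm u"
    proof (rule mult_right_mono)
      have "CARD('p) * norm (transpose (X i)) \<le> real (CARD('r) + CARD('p)) * (\<bar>B0\<bar> + \<bar>B1\<bar>)"
        using B1[OF X[OF that]] by (intro mult_mono) auto
      then show "CARD('p) * norm (transpose (X i)) \<le> C" by (simp add: C_def)
    qed simp
    finally show ?thesis .
  qed
  moreover have "C > 0" by (simp add: C_def add_nonneg_pos)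
  ultimately show ?thesis using that by blast
qed

lemma compact_linear_predictors: "compact ((\<lambda>x. x *v \<beta>\<^sub>0) ` \<X>)" "(\<lambda>x. x *v \<beta>\<^sub>0) ` \<X> \<subseteq> \<Theta>"
proof -
  show "compact ((\<lambda>x. x *v \<beta>\<^sub>0) ` \<X>)"
    unfolding matrix_vector_mult_def
    by (intro compact_continuous_image compact_\<X> continuous_on_vec_lambda continuous_intros)
  show "(\<lambda>x. x *v \<beta>\<^sub>0) ` \<X> \<subseteq> \<Theta>" using linear_predictor \<beta>\<^sub>0 by auto
qed

lemma weighted_gram_quadratic:
  "u \<bullet> (weighted_gram \<nu> b \<beta>\<^sub>0 x *v u) = (x *v u) \<bullet> (hessian a (x *v \<beta>\<^sub>0) *v (x *v u))"
  unfolding weighted_gram_def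
  by (simp add: matrix_vector_mul_assoc[symmetric] dot_vector_matrix_mult)

lemma sum_matrix_vector_mult:
  fixes A :: "'i \<Rightarrow> real^'n^'m"
  shows "(\<Sum>i\<in>I. A i) *v u = (\<Sum>i\<in>I. A i *v u)"
  by (induction I rule: infinite_finite_induct) (auto simp: matrix_vector_mult_add_rdistrib)

text \<open>Two errors are controlled: n Taylor remainders, each of order 1/n with an arbitrarily
  small factor, uniformly over the compact set of predictors, and the distance of the averaged Gram
  matrices from J.\<close>

lemma D_limit:
  assumes \<epsilon>: "\<epsilon> > 0"
  shows "eventually (\<lambda>n. \<forall>u. norm u \<le> R \<longrightarrow> \<bar>D n u - u \<bullet> (J *v u) / 2\<bar> \<le> \<epsilon>) sequentially"
proof -
  obtain B where B: "B > 0" "\<And>i u. i \<ge> 1 \<Longrightarrow> norm (X i *v u) \<le> B * norm u"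
    using X_bounded by metis
  \<comment> \<open>A strictly positive substitute for the squared radius, so that it may be divided
    by even when R is 0.\<close>
  define q where "q = R\<^sup>2 + 1"
  have q: "q > 0" "R\<^sup>2 \<le> q" by (auto simp: q_def add_nonneg_pos)
  \<comment> \<open>The n remainders add up to at most \<open>e * B\<^sup>2 * q\<close>, which is
    half of \<epsilon>.\<close>
  define e where "e = \<epsilon> / (2 * B\<^sup>2 * q)"
  then have e: "e > 0" using \<epsilon> B(1) q(1) by (simp add: e_def)
  obtain \<delta> where \<delta>: "\<delta> > 0" "\<And>\<theta> h. \<theta> \<in> (\<lambda>x. x *v \<beta>\<^sub>0) ` \<X> \<Longrightarrow> norm h \<le> \<delta> \<Longrightarrow>
    \<bar>a (\<theta> + h) - a \<theta> - h \<bullet> mean \<theta> - h \<bullet> (hessian a \<theta> *v h) / 2\<bar> \<le> e * (norm h)\<^sup>2"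
    using uniform_taylor2[of \<Theta> a mean "hessian a", OF cumulant_GDERIV_gradient
        gradient_cumulant_has_derivative continuous_on_hessian_cumulant open_interior
        compact_linear_predictors e] by blast
  define G where "G n = (1 / real n) *\<^sub>R (\<Sum>i\<in>{1..n}. weighted_gram \<nu> b \<beta>\<^sub>0 (X i))" for n
  have "(\<lambda>n. norm (G n - J)) \<longlonglongrightarrow> 0"
    using gram_limit by (simp add: G_def[abs_def] tendsto_norm_zero LIM_zero)
  then have "eventually (\<lambda>n. norm (G n - J) < \<epsilon> / (CARD('p) * q)) sequentially"
    using \<epsilon> q(1) by (intro order_tendstoD(2)) auto
  moreover have "(\<lambda>n. 1 / sqrt (real n) * (B * R)) \<longlonglongrightarrow> 0" by real_asymp
  then have "eventually (\<lambda>n. 1 / sqrt (real n) * (B * R) < \<delta>) sequentially"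
    using \<delta>(1) order_tendstoD(2) by blast
  ultimately show ?thesis using eventually_ge_at_top[of 1]
  proof eventually_elim
    case (elim n)
    let ?r = "1 / sqrt (real n)"
    show ?case
    proof (intro allI impI)
      fix u :: "real^'p" assume u: "norm u \<le> R"
      then have R: "0 \<le> R" using norm_ge_zero order_trans by blast
      have u2: "(norm u)\<^sup>2 \<le> R\<^sup>2" using u by (intro power_mono) auto
      define h where "h i = X i *v (?r *\<^sub>R u)" for i
      have h: "norm (h i) \<le> ?r * (B * R)" if "i \<ge> 1" for i
      proof -
        have "norm (h i) = ?r * norm (X i *v u)" by (simp add: h_def matrix_vector_mult_scaleR)
        also have "\<dots> \<le> ?r * (B * R)"
        proof (rule mult_left_mono)
          have "B * norm u \<le> B * R" using B(1) u by (intro mult_left_mono) auto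
          then show "norm (X i *v u) \<le> B * R" using B(2)[OF that, of u] by linarith
        qed simp
        finally show ?thesis .
      qed
      have rem: "\<bar>excess (X i) (?r *\<^sub>R u) - h i \<bullet> (hessian a (X i *v \<beta>\<^sub>0) *v h i) / 2\<bar> \<le> e * (B\<^sup>2 * R\<^sup>2 / n)"
        if "i \<in> {1..n}" for i
      proof -
        have i: "i \<ge> 1" using that by simp
        have "\<bar>excess (X i) (?r *\<^sub>R u) - h i \<bullet> (hessian a (X i *v \<beta>\<^sub>0) *v h i) / 2\<bar> \<le> e * (norm (h i))\<^sup>2"
          using \<delta>(2)[of "X i *v \<beta>\<^sub>0" "h i"] X[OF i] h[OF i] elim(2)
          by (simp add: excess_def h_def matrix_vector_right_distrib)
        also have "(norm (h i))\<^sup>2 \<le> (?r * (B * R))\<^sup>2" using h[OF i] by (intro power_mono) auto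
        also have "(?r * (B * R))\<^sup>2 = B\<^sup>2 * R\<^sup>2 / n" using elim(3) by (simp add: power_mult_distrib power_divide)
        finally show ?thesis using e by simp
      qed
      have "(\<Sum>i\<in>{1..n}. h i \<bullet> (hessian a (X i *v \<beta>\<^sub>0) *v h i) / 2) = u \<bullet> (G n *v u) / 2"
      proof -
        have "u \<bullet> (G n *v u) = (\<Sum>i\<in>{1..n}. (1 / real n) * ((X i *v u) \<bullet> (hessian a (X i *v \<beta>\<^sub>0) *v (X i *v u))))"
          unfolding G_def weighted_gram_quadratic[symmetric]
          by (simp add: scaleR_matrix_vector_assoc[symmetric] sum_matrix_vector_mult inner_sum_right sum_divide_distrib)
        also have "\<dots> = (\<Sum>i\<in>{1..n}. h i \<bullet> (hessian a (X i *v \<beta>\<^sub>0) *v h i))"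
        proof (rule sum.cong[OF refl])
          fix i
          have "?r * ?r = 1 / real n" using elim(3) by simp
          then show "(1 / real n) * ((X i *v u) \<bullet> (hessian a (X i *v \<beta>\<^sub>0) *v (X i *v u)))
              = h i \<bullet> (hessian a (X i *v \<beta>\<^sub>0) *v h i)"
            unfolding h_def by (simp add: matrix_vector_mult_scaleR)
        qed
        finally show ?thesis by (simp add: sum_divide_distrib)
      qed
      then have "D n u - u \<bullet> (G n *v u) / 2
          = (\<Sum>i\<in>{1..n}. excess (X i) (?r *\<^sub>R u) - h i \<bullet> (hessian a (X i *v \<beta>\<^sub>0) *v h i) / 2)"
        by (simp only: D_def sum_subtractf)
      then have "\<bar>D n u - u \<bullet> (G n *v u) / 2\<bar>
          \<le> (\<Sum>i\<in>{1..n}. \<bar>excess (X i) (?r *\<^sub>R u) - h i \<bullet> (hessian a (X i *v \<beta>\<^sub>0) *v h i) / 2\<bar>)"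
        by (simp only: sum_abs)
      also have "\<dots> \<le> (\<Sum>i\<in>{1..n}. e * (B\<^sup>2 * R\<^sup>2 / n))" by (intro sum_mono rem)
      also have "\<dots> = e * B\<^sup>2 * R\<^sup>2" using elim(3) by simp
      also have "\<dots> \<le> e * B\<^sup>2 * q" using e q(2) by (intro mult_left_mono) auto
      also have "\<dots> = \<epsilon> / 2" using B(1) q by (simp add: e_def)
      finally have 1: "\<bar>D n u - u \<bullet> (G n *v u) / 2\<bar> \<le> \<epsilon> / 2" .
      \<comment> \<open>The forms enter halved, so a difference of \<epsilon> between them uses up
        the remaining half.\<close>
      have "\<bar>u \<bullet> (G n *v u) - u \<bullet> (J *v u)\<bar> = \<bar>u \<bullet> ((G n - J) *v u)\<bar>"
        by (simp add: matrix_vector_mult_diff_rdistrib inner_diff_right)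
      also have "\<dots> \<le> CARD('p) * norm (G n - J) * (norm u)\<^sup>2" by (rule abs_quadratic_form_le)
      also have "\<dots> \<le> CARD('p) * (\<epsilon> / (CARD('p) * q)) * q"
        using elim(1) u2 \<epsilon> q by (intro mult_mono) auto
      also have "\<dots> = \<epsilon>" using q by simp
      finally show "\<bar>D n u - u \<bullet> (J *v u) / 2\<bar> \<le> \<epsilon>" using 1 by linarith
    qed
  qed
qed

lemma gradient_loglik:
  assumes "x \<in> \<X>"
  shows "gradient (loglik \<nu> b x v) \<beta>\<^sub>0 = transpose x *v (v - mean (x *v \<beta>\<^sub>0))"
proof (rule gradient_eqI)
  have bl: "bounded_linear ((*v) x)" by (rule matrix_vector_mul_bounded_linear)
  have "(a has_derivative (\<lambda>h. h \<bullet> mean (x *v \<beta>\<^sub>0))) (at (x *v \<beta>\<^sub>0))"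
    using cumulant_GDERIV_gradient[OF linear_predictor[OF assms \<beta>\<^sub>0]] by (simp add: gderiv_def)
  then have "((\<lambda>\<beta>. a (x *v \<beta>)) has_derivative (\<lambda>h. (x *v h) \<bullet> mean (x *v \<beta>\<^sub>0))) (at \<beta>\<^sub>0)"
    by (rule has_derivative_compose[OF bounded_linear_imp_has_derivative[OF bl]])
  then have "((\<lambda>\<beta>. v \<bullet> (x *v \<beta>) - a (x *v \<beta>) + b v) has_derivative
      (\<lambda>h. v \<bullet> (x *v h) - (x *v h) \<bullet> mean (x *v \<beta>\<^sub>0) + 0)) (at \<beta>\<^sub>0)"
    by (intro has_derivative_add has_derivative_diff has_derivative_inner_right
        bounded_linear_imp_has_derivative[OF bl] has_derivative_const)
  moreover have "v \<bullet> (x *v h) - (x *v h) \<bullet> mean (x *v \<beta>\<^sub>0) + 0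
      = h \<bullet> (transpose x *v (v - mean (x *v \<beta>\<^sub>0)))" for h
    by (simp add: dot_vector_matrix_mult inner_diff_right inner_commute)
  ultimately show "GDERIV (loglik \<nu> b x v) \<beta>\<^sub>0 :> transpose x *v (v - mean (x *v \<beta>\<^sub>0))"
    by (simp add: gderiv_def loglik_def[abs_def])
qed

lemma score_eq:
  "score \<nu> b X \<beta>\<^sub>0 y n \<omega> =
     (1 / sqrt (real n)) *\<^sub>R (\<Sum>i\<in>{1..n}. transpose (X i) *v (y i \<omega> - mean (X i *v \<beta>\<^sub>0)))"
proof -
  have "(\<Sum>i\<in>{1..n}. gradient (loglik \<nu> b (X i) (y i \<omega>)) \<beta>\<^sub>0)
    = (\<Sum>i\<in>{1..n}. transpose (X i) *v (y i \<omega> - mean (X i *v \<beta>\<^sub>0)))"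
    by (intro sum.cong refl gradient_loglik X) auto
  then show ?thesis by (simp add: score_def powr_minus_divide powr_half_sqrt)
qed

end

locale bridge_glm = glm \<nu> b \<B> \<beta>\<^sub>0 \<X> X J
  for \<nu> :: "(real^'r) measure" and b :: "real^'r \<Rightarrow> real"
    and \<B> :: "(real^'p) set" and \<beta>\<^sub>0 :: "real^'p" and \<X> :: "(real^'p^'r) set"
    and X :: "nat \<Rightarrow> real^'p^'r" and J :: "real^'p^'p" +
  fixes \<gamma> \<gamma>\<^sub>0 lam :: real
  assumes \<gamma>: "0 < \<gamma>" "\<gamma> < 1" "\<gamma> < \<gamma>\<^sub>0" "\<gamma>\<^sub>0 \<le> 1" and lam: "0 < lam"
begin

sublocale bridge_limit \<beta>\<^sub>0 \<B> D J \<gamma> \<gamma>\<^sub>0 lam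
proof
  show "D n 0 = 0" for n by (simp add: D_def excess_def)
qed (use open_\<B> \<beta>\<^sub>0 D_convex D_nonneg D_limit J \<gamma> lam in blast)+

text \<open>An exact identity rather than an expansion: under the natural link the response
  multiplies the parameter linearly, and once that linear term is centred into the score only
  \<open>excess\<close> is left of the likelihood.\<close>

lemma bridge_objective_eq:
  assumes "n \<ge> 1"
  shows "bridge_objective \<nu> b X \<gamma> (real n powr ((\<gamma>\<^sub>0 - 2) / 2) * lam) n (\<lambda>i. y i \<omega>)
      (\<beta>\<^sub>0 + (1 / sqrt (real n)) *\<^sub>R u)
    = bridge_objective \<nu> b X \<gamma> (real n powr ((\<gamma>\<^sub>0 - 2) / 2) * lam) n (\<lambda>i. y i \<omega>) \<beta>\<^sub>0
      + V n (score \<nu> b X \<beta>\<^sub>0 y n \<omega>) u"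
proof -
  let ?r = "1 / sqrt (real n)"
  have "real n * (real n powr ((\<gamma>\<^sub>0 - 2) / 2) * lam) = lam * (real n powr 1 * real n powr ((\<gamma>\<^sub>0 - 2) / 2))"
    using assms by simp
  also have "real n powr 1 * real n powr ((\<gamma>\<^sub>0 - 2) / 2) = real n powr (\<gamma>\<^sub>0 / 2)"
    unfolding powr_add[symmetric] by (simp add: diff_divide_distrib)
  finally have pw: "real n * (real n powr ((\<gamma>\<^sub>0 - 2) / 2) * lam) = lam * real n powr (\<gamma>\<^sub>0 / 2)" .
  have "(\<Sum>i\<in>{1..n}. loglik \<nu> b (X i) (y i \<omega>) (\<beta>\<^sub>0 + ?r *\<^sub>R u))
      = (\<Sum>i\<in>{1..n}. loglik \<nu> b (X i) (y i \<omega>) \<beta>\<^sub>0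
         + ?r * ((transpose (X i) *v (y i \<omega> - mean (X i *v \<beta>\<^sub>0))) \<bullet> u) - excess (X i) (?r *\<^sub>R u))"
  proof (rule sum.cong[OF refl])
    fix i
    have "?r * ((transpose (X i) *v (y i \<omega> - mean (X i *v \<beta>\<^sub>0))) \<bullet> u)
        = (y i \<omega> - mean (X i *v \<beta>\<^sub>0)) \<bullet> (X i *v (?r *\<^sub>R u))"
      by (simp add: inner_commute[of _ u] dot_vector_matrix_mult matrix_vector_mult_scaleR)
         (simp add: inner_commute)
    also have "\<dots> = y i \<omega> \<bullet> (X i *v (?r *\<^sub>R u)) - (X i *v (?r *\<^sub>R u)) \<bullet> mean (X i *v \<beta>\<^sub>0)"
      by (simp only: inner_diff_left inner_commute[of "mean _"])
    finally have "?r * ((transpose (X i) *v (y i \<omega> - mean (X i *v \<beta>\<^sub>0))) \<bullet> u)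
      = y i \<omega> \<bullet> (X i *v (?r *\<^sub>R u)) - (X i *v (?r *\<^sub>R u)) \<bullet> mean (X i *v \<beta>\<^sub>0)" .
    then show "loglik \<nu> b (X i) (y i \<omega>) (\<beta>\<^sub>0 + ?r *\<^sub>R u) = loglik \<nu> b (X i) (y i \<omega>) \<beta>\<^sub>0
         + ?r * ((transpose (X i) *v (y i \<omega> - mean (X i *v \<beta>\<^sub>0))) \<bullet> u) - excess (X i) (?r *\<^sub>R u)"
      unfolding loglik_def excess_def matrix_vector_right_distrib inner_add_right by linarith
  qed
  also have "\<dots> = (\<Sum>i\<in>{1..n}. loglik \<nu> b (X i) (y i \<omega>) \<beta>\<^sub>0) + score \<nu> b X \<beta>\<^sub>0 y n \<omega> \<bullet> u - D n u"
    by (simp add: sum.distrib sum_subtractf D_def score_eq inner_sum_left sum_divide_distrib)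
  finally have ll: "(\<Sum>i\<in>{1..n}. loglik \<nu> b (X i) (y i \<omega>) (\<beta>\<^sub>0 + ?r *\<^sub>R u))
    = (\<Sum>i\<in>{1..n}. loglik \<nu> b (X i) (y i \<omega>) \<beta>\<^sub>0) + score \<nu> b X \<beta>\<^sub>0 y n \<omega> \<bullet> u - D n u" .
  show ?thesis
    unfolding bridge_objective_def ll pw V_def pen_def sum_subtractf
    by (simp only: right_diff_distrib)
qed

text \<open>For positive n, rescaling around the true parameter is a bijection of
  \<open>\<B>\<close> onto the local domain, and the two objectives differ by a constant.\<close>

lemma is_arg_min_bridge_objective:
  assumes "n \<ge> 1"
  shows "is_arg_min (bridge_objective \<nu> b X \<gamma> (real n powr ((\<gamma>\<^sub>0 - 2) / 2) * lam) n (\<lambda>i. y i \<omega>))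
      (\<lambda>\<beta>. \<beta> \<in> \<B>) \<beta>
    \<longleftrightarrow> is_minimizer n (score \<nu> b X \<beta>\<^sub>0 y n \<omega>) (sqrt (real n) *\<^sub>R (\<beta> - \<beta>\<^sub>0))"
proof -
  let ?f = "bridge_objective \<nu> b X \<gamma> (real n powr ((\<gamma>\<^sub>0 - 2) / 2) * lam) n (\<lambda>i. y i \<omega>)"
  let ?V = "V n (score \<nu> b X \<beta>\<^sub>0 y n \<omega>)"
  let ?e = "\<lambda>\<beta>. sqrt (real n) *\<^sub>R (\<beta> - \<beta>\<^sub>0)" and ?d = "\<lambda>u. \<beta>\<^sub>0 + (1 / sqrt (real n)) *\<^sub>R u"
  have de: "?d (?e \<beta>) = \<beta>" for \<beta> using assms by simp
  have f: "?f \<beta> = ?f \<beta>\<^sub>0 + ?V (?e \<beta>)" for \<beta>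
    using bridge_objective_eq[OF assms, where u = "?e \<beta>"] by (simp only: de)
  have mem: "?e \<beta> \<in> local_domain n \<longleftrightarrow> \<beta> \<in> \<B>" for \<beta> unfolding local_domain_def by (simp only: de mem_Collect_eq)
  have ed: "?e (?d u) = u" for u using assms by simp
  have "(\<forall>w\<in>local_domain n. ?V (?e \<beta>) \<le> ?V w) \<longleftrightarrow> (\<forall>\<beta>'\<in>\<B>. ?V (?e \<beta>) \<le> ?V (?e \<beta>'))"
    using mem ed by metis
  then show ?thesis
    unfolding is_arg_min_def is_minimizer_def mem using f[of \<beta>] f by (metis add_le_cancel_left not_le)
qed

end

section \<open>Tightness of the score\<close>

text \<open>A new summand is independent of the sum of the others, so the cross term has the product
  of the means as its expectation, which is 0.\<close>

lemma (in prob_space) expectation_sum_squared_indep: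
  fixes Z :: "'i \<Rightarrow> 'a \<Rightarrow> real"
  assumes "finite I" "indep_vars (\<lambda>_. borel) Z I"
    and "\<And>i. i \<in> I \<Longrightarrow> integrable M (\<lambda>\<omega>. (Z i \<omega>)\<^sup>2)" "\<And>i. i \<in> I \<Longrightarrow> expectation (Z i) = 0"
  shows "integrable M (\<lambda>\<omega>. (\<Sum>i\<in>I. Z i \<omega>)\<^sup>2) \<and>
    expectation (\<lambda>\<omega>. (\<Sum>i\<in>I. Z i \<omega>)\<^sup>2) = (\<Sum>i\<in>I. expectation (\<lambda>\<omega>. (Z i \<omega>)\<^sup>2))"
  using assms
proof (induction I rule: finite_induct)
  case (insert i I)
  have rv: "random_variable borel (Z k)" if "k \<in> insert i I" for k
    using insert.prems(1) that unfolding indep_vars_def by blast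
  have int: "integrable M (Z k)" if "k \<in> insert i I" for k
    using rv[OF that] insert.prems(2)[OF that] by (rule square_integrable_imp_integrable)
  let ?T = "\<lambda>\<omega>. \<Sum>k\<in>I. Z k \<omega>"
  have IH: "integrable M (\<lambda>\<omega>. (?T \<omega>)\<^sup>2)"
      "expectation (\<lambda>\<omega>. (?T \<omega>)\<^sup>2) = (\<Sum>k\<in>I. expectation (\<lambda>\<omega>. (Z k \<omega>)\<^sup>2))"
    using insert.IH insert.prems indep_vars_subset[OF insert.prems(1)] by auto
  have T: "integrable M ?T" using int by (intro Bochner_Integration.integrable_sum) auto
  have ind: "indep_var borel (Z i) borel ?T"
    by (rule indep_vars_sum[OF insert.hyps insert.prems(1)])
  have Zi: "integrable M (Z i)" using int by simp
  have cross: "integrable M (\<lambda>\<omega>. Z i \<omega> * ?T \<omega>)" "expectation (\<lambda>\<omega>. Z i \<omega> * ?T \<omega>) = 0"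
    using indep_var_integrable[OF ind Zi T] indep_var_lebesgue_integral[OF ind Zi T] insert.prems(3)
    by auto
  have sq: "integrable M (\<lambda>\<omega>. (Z i \<omega>)\<^sup>2)" using insert.prems(2) by simp
  have eq: "(\<Sum>k\<in>insert i I. Z k \<omega>)\<^sup>2 = (Z i \<omega>)\<^sup>2 + 2 * (Z i \<omega> * ?T \<omega>) + (?T \<omega>)\<^sup>2" for \<omega>
    using insert.hyps by (simp add: power2_sum mult.assoc)
  show ?case
    unfolding eq using sq cross IH insert.hyps by simp
qed simp

lemma norm_power2_vec: "(norm (x :: real^'n))\<^sup>2 = (\<Sum>j\<in>UNIV. (x $ j)\<^sup>2)"
  unfolding power2_norm_eq_inner by (simp add: inner_vec_def power2_eq_square)

lemma borel_measurable_matrix_vector_mult [measurable]: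
  fixes A :: "real^'n^'m"
  shows "(*v) A \<in> borel_measurable borel"
  by (intro borel_measurable_continuous_onI continuous_intros)

lemma borel_measurable_subvec [measurable]: "subvec S \<in> borel_measurable borel"
proof -
  have "subvec S = (*v) (submat S (mat 1))" by (simp add: fun_eq_iff submat_mat_1_vec)
  then show ?thesis using borel_measurable_matrix_vector_mult by simp
qed

context exp_family
begin

text \<open>On the interior, \<open>exp (cumulant \<nu> b \<theta>)\<close> is the normalizing
  integral; dividing by it turns the integral against the density into the ratio
  \<open>moment\<close>.\<close>

lemma distributed_moment:
  assumes Y: "distributed M \<nu> Y (\<lambda>v. ennreal (nef_density \<nu> b \<theta> v))"
    and \<theta>: "\<theta> \<in> \<Theta>" and \<phi>: "poly_growth \<phi>"
  shows "integrable M (\<lambda>\<omega>. \<phi> (Y \<omega>))" "(\<integral>\<omega>. \<phi> (Y \<omega>) \<partial>M) = moment \<phi> \<theta>"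
proof -
  have \<phi>m: "\<phi> \<in> borel_measurable \<nu>"
    using \<phi> by (simp add: poly_growth_def cong: measurable_cong_sets[OF sets_\<nu>])
  let ?Z = "weighted_integral (\<lambda>_. 1) \<theta>"
  have "exp (cumulant \<nu> b \<theta>) = ?Z"
    using weighted_integral_one_pos[OF \<theta>] by (simp add: cumulant_def weighted_integral_def)
  moreover have "nef_density \<nu> b \<theta> v = exp (v \<bullet> \<theta> + b v) / exp (cumulant \<nu> b \<theta>)" for v
    by (simp add: nef_density_def exp_diff[symmetric] algebra_simps)
  ultimately have eq: "nef_density \<nu> b \<theta> v * \<phi> v = (\<phi> v * exp (v \<bullet> \<theta> + b v)) / ?Z" for v
    by simp
  have nn: "0 \<le> nef_density \<nu> b \<theta> v" for v by (simp add: nef_density_def)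
  show "integrable M (\<lambda>\<omega>. \<phi> (Y \<omega>))"
    using distributed_integrable[OF Y \<phi>m nn] integrable_poly_growth[OF \<theta> \<phi>] unfolding eq by simp
  show "(\<integral>\<omega>. \<phi> (Y \<omega>) \<partial>M) = moment \<phi> \<theta>"
    using distributed_integral[OF Y \<phi>m nn] unfolding eq by (simp add: moment_def weighted_integral_def)
qed

end

context glm
begin

context
  fixes M :: "'w measure" and y :: "nat \<Rightarrow> 'w \<Rightarrow> real^'r"
  assumes prob_space_M: "prob_space M"
    and indep: "prob_space.indep_vars M (\<lambda>_. borel) y {1..}"
    and y_distributed:
      "\<And>i. i \<ge> 1 \<Longrightarrow> distributed M \<nu> (y i) (\<lambda>v. ennreal (nef_density \<nu> b (X i *v \<beta>\<^sub>0) v))"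
begin

interpretation prob_space M by (rule prob_space_M)

definition noise :: "nat \<Rightarrow> 'w \<Rightarrow> real^'r" where
  "noise i \<omega> = y i \<omega> - mean (X i *v \<beta>\<^sub>0)"

lemma y_measurable: "i \<ge> 1 \<Longrightarrow> y i \<in> borel_measurable M"
  using indep unfolding indep_vars_def by auto

lemma X_\<Theta>: "i \<ge> 1 \<Longrightarrow> X i *v \<beta>\<^sub>0 \<in> \<Theta>"
  by (intro linear_predictor X \<beta>\<^sub>0)

text \<open>The variance is at most the raw second moment, which is a continuous function of the
  linear predictor and so bounded on the compact set of predictors.\<close>

lemma noise_nth:
  assumes "i \<ge> 1"
  shows "integrable M (\<lambda>\<omega>. noise i \<omega> $ k)" "expectation (\<lambda>\<omega>. noise i \<omega> $ k) = 0"
    "integrable M (\<lambda>\<omega>. (noise i \<omega> $ k)\<^sup>2)"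
    "expectation (\<lambda>\<omega>. (noise i \<omega> $ k)\<^sup>2) \<le> moment (\<lambda>v. v $ k * v $ k) (X i *v \<beta>\<^sub>0)"
proof -
  define m where "m = moment (\<lambda>v. v $ k) (X i *v \<beta>\<^sub>0)"
  have noise: "noise i \<omega> $ k = y i \<omega> $ k - m" for \<omega>
    by (simp add: noise_def gradient_cumulant[OF X_\<Theta>[OF assms]] m_def)
  note 1 = distributed_moment[OF y_distributed[OF assms] X_\<Theta>[OF assms] poly_growth_nth[of k]]
  note 2 = distributed_moment[OF y_distributed[OF assms] X_\<Theta>[OF assms]
      poly_growth_mult_nth[OF poly_growth_nth[of k], of k]]
  show "integrable M (\<lambda>\<omega>. noise i \<omega> $ k)" "expectation (\<lambda>\<omega>. noise i \<omega> $ k) = 0"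
    unfolding noise using 1 by (simp_all add: m_def prob_space)
  have sq: "(noise i \<omega> $ k)\<^sup>2 = y i \<omega> $ k * y i \<omega> $ k - 2 * m * y i \<omega> $ k + m\<^sup>2" for \<omega>
    unfolding noise by (simp add: power2_eq_square algebra_simps)
  show "integrable M (\<lambda>\<omega>. (noise i \<omega> $ k)\<^sup>2)" unfolding sq using 1 2 by simp
  have "expectation (\<lambda>\<omega>. (noise i \<omega> $ k)\<^sup>2) = moment (\<lambda>v. v $ k * v $ k) (X i *v \<beta>\<^sub>0) - m\<^sup>2"
    unfolding sq using 1 2 by (simp add: prob_space m_def power2_eq_square)
  then show "expectation (\<lambda>\<omega>. (noise i \<omega> $ k)\<^sup>2) \<le> moment (\<lambda>v. v $ k * v $ k) (X i *v \<beta>\<^sub>0)"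
    by simp
qed

lemma noise_second_moment_bounded:
  obtains C where "\<And>i. i \<ge> 1 \<Longrightarrow> expectation (\<lambda>\<omega>. (norm (noise i \<omega>))\<^sup>2) \<le> C"
proof -
  let ?f = "\<lambda>\<theta>. \<Sum>k\<in>UNIV. moment (\<lambda>v. v $ k * v $ k) \<theta>"
  have "continuous_on ((\<lambda>x. x *v \<beta>\<^sub>0) ` \<X>) ?f"
    using compact_linear_predictors(2)
    by (intro continuous_on_sum continuous_at_imp_continuous_on ballI moment_isCont
        poly_growth_mult_nth poly_growth_nth) auto
  then have "bounded (?f ` ((\<lambda>x. x *v \<beta>\<^sub>0) ` \<X>))"
    by (intro compact_imp_bounded compact_continuous_image compact_linear_predictors)
  then obtain C where C: "\<And>x. x \<in> \<X> \<Longrightarrow> \<bar>?f (x *v \<beta>\<^sub>0)\<bar> \<le> C"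
    unfolding bounded_iff by auto
  have "expectation (\<lambda>\<omega>. (norm (noise i \<omega>))\<^sup>2) \<le> C" if i: "i \<ge> 1" for i
  proof -
    have "expectation (\<lambda>\<omega>. (norm (noise i \<omega>))\<^sup>2) = (\<Sum>k\<in>UNIV. expectation (\<lambda>\<omega>. (noise i \<omega> $ k)\<^sup>2))"
      unfolding norm_power2_vec by (rule Bochner_Integration.integral_sum) (rule noise_nth(3)[OF i])
    also have "\<dots> \<le> ?f (X i *v \<beta>\<^sub>0)" by (intro sum_mono noise_nth(4)[OF i])
    finally show ?thesis using C[OF X[OF i]] by linarith
  qed
  then show ?thesis using that by blast
qed

lemma score_measurable: "score \<nu> b X \<beta>\<^sub>0 y n \<in> borel_measurable M"
proof -
  have "(\<lambda>\<omega>. transpose (X i) *v (y i \<omega> - mean (X i *v \<beta>\<^sub>0))) \<in> borel_measurable M" if "i \<in> {1..n}" for i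
    using y_measurable[of i] that
    by (intro measurable_compose[OF _ borel_measurable_matrix_vector_mult] borel_measurable_diff) auto
  then show ?thesis
    unfolding score_eq[abs_def] by (intro borel_measurable_scaleR borel_measurable_sum) auto
qed

text \<open>Coordinatewise the score is a sum of independent centred variables, so its second moment
  is a sum of n uniformly bounded terms, and the normalization 1/n cancels their number.\<close>

lemma score_second_moment_bounded:
  obtains C where "\<And>n. n \<ge> 1 \<Longrightarrow> integrable M (\<lambda>\<omega>. (norm (score \<nu> b X \<beta>\<^sub>0 y n \<omega>))\<^sup>2)"
    "\<And>n. n \<ge> 1 \<Longrightarrow> expectation (\<lambda>\<omega>. (norm (score \<nu> b X \<beta>\<^sub>0 y n \<omega>))\<^sup>2) \<le> C"
proof -
  obtain B where B: "B > 0" "\<And>i v. i \<ge> 1 \<Longrightarrow> norm (transpose (X i) *v v) \<le> B * norm v"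
    using X_bounded by metis
  obtain C where C: "\<And>i. i \<ge> 1 \<Longrightarrow> expectation (\<lambda>\<omega>. (norm (noise i \<omega>))\<^sup>2) \<le> C"
    using noise_second_moment_bounded by blast
  define T where "T i \<omega> = transpose (X i) *v noise i \<omega>" for i \<omega>
  have T_measurable: "T i \<in> borel_measurable M" if "i \<ge> 1" for i
    unfolding T_def noise_def using y_measurable[OF that]
    by (intro measurable_compose[OF _ borel_measurable_matrix_vector_mult] borel_measurable_diff) auto
  have noise_sq: "integrable M (\<lambda>\<omega>. (norm (noise i \<omega>))\<^sup>2)" if "i \<ge> 1" for i
    unfolding norm_power2_vec by (intro Bochner_Integration.integrable_sum noise_nth(3)[OF that])
  have T_bound: "(norm (T i \<omega>))\<^sup>2 \<le> B\<^sup>2 * (norm (noise i \<omega>))\<^sup>2" if "i \<ge> 1" for i \<omega>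
    using power_mono[OF B(2)[OF that, of "noise i \<omega>"], of 2] by (simp add: T_def power_mult_distrib)
  have T_sq: "integrable M (\<lambda>\<omega>. (T i \<omega> $ j)\<^sup>2)" if "i \<ge> 1" for i j
  proof (rule Bochner_Integration.integrable_bound)
    show "integrable M (\<lambda>\<omega>. B\<^sup>2 * (norm (noise i \<omega>))\<^sup>2)" using noise_sq[OF that] by simp
    have "(\<lambda>v :: real^'p. (v $ j)\<^sup>2) \<in> borel_measurable borel"
      by (intro borel_measurable_continuous_onI continuous_intros)
    from measurable_compose[OF T_measurable[OF that] this]
    show "(\<lambda>\<omega>. (T i \<omega> $ j)\<^sup>2) \<in> borel_measurable M" .
    show "AE \<omega> in M. norm ((T i \<omega> $ j)\<^sup>2) \<le> norm (B\<^sup>2 * (norm (noise i \<omega>))\<^sup>2)"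
    proof (rule AE_I2)
      fix \<omega>
      have "(T i \<omega> $ j)\<^sup>2 \<le> (norm (T i \<omega>))\<^sup>2"
        using component_le_norm_cart[of "T i \<omega>" j] by (metis abs_ge_zero power2_abs power_mono)
      then show "norm ((T i \<omega> $ j)\<^sup>2) \<le> norm (B\<^sup>2 * (norm (noise i \<omega>))\<^sup>2)"
        using T_bound[OF that, of \<omega>] by simp
    qed
  qed
  have T_mean: "expectation (\<lambda>\<omega>. T i \<omega> $ j) = 0" if "i \<ge> 1" for i j
  proof -
    have "T i \<omega> $ j = (\<Sum>k\<in>UNIV. transpose (X i) $ j $ k * noise i \<omega> $ k)" for \<omega>
      by (simp only: T_def matrix_vector_mult_def vec_lambda_beta)
    then show ?thesis
      using noise_nth(1,2)[OF that] by (simp add: Bochner_Integration.integral_sum)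
  qed
  have T_indep: "indep_vars (\<lambda>_. borel) (\<lambda>i \<omega>. T i \<omega> $ j) {1..n}" for j n
  proof -
    have "indep_vars (\<lambda>_. borel) y {1..n}" by (rule indep_vars_subset[OF indep]) auto
    then show ?thesis
      unfolding T_def noise_def
      by (rule indep_vars_compose2[where Y = "\<lambda>i v. (transpose (X i) *v (v - mean (X i *v \<beta>\<^sub>0))) $ j"])
        (unfold matrix_vector_mult_diff_distrib, intro borel_measurable_continuous_onI continuous_intros)
  qed
  note sum_sq = expectation_sum_squared_indep[OF _ T_indep T_sq T_mean]
  have score: "(norm (score \<nu> b X \<beta>\<^sub>0 y n \<omega>))\<^sup>2 = (1 / real n) * (\<Sum>j\<in>UNIV. (\<Sum>i\<in>{1..n}. T i \<omega> $ j)\<^sup>2)"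
    for n \<omega>
    by (simp add: score_eq T_def noise_def power_divide norm_power2_vec)
  have "integrable M (\<lambda>\<omega>. (norm (score \<nu> b X \<beta>\<^sub>0 y n \<omega>))\<^sup>2)" for n
    unfolding score using sum_sq by (intro integrable_mult_right Bochner_Integration.integrable_sum) auto
  moreover have "expectation (\<lambda>\<omega>. (norm (score \<nu> b X \<beta>\<^sub>0 y n \<omega>))\<^sup>2) \<le> B\<^sup>2 * C" if n: "n \<ge> 1" for n
  proof -
    have "expectation (\<lambda>\<omega>. (norm (score \<nu> b X \<beta>\<^sub>0 y n \<omega>))\<^sup>2)
      = (1 / real n) * (\<Sum>j\<in>UNIV. \<Sum>i\<in>{1..n}. expectation (\<lambda>\<omega>. (T i \<omega> $ j)\<^sup>2))"
      unfolding score using sum_sq by (simp add: Bochner_Integration.integral_sum)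
    \<comment> \<open>Exchanging the sums reassembles the coordinates of each summand into its norm,
      to which the bound on the regressors applies.\<close>
    also have "(\<Sum>j\<in>UNIV. \<Sum>i\<in>{1..n}. expectation (\<lambda>\<omega>. (T i \<omega> $ j)\<^sup>2))
      = (\<Sum>i\<in>{1..n}. expectation (\<lambda>\<omega>. (norm (T i \<omega>))\<^sup>2))"
      unfolding norm_power2_vec using T_sq
      by (subst sum.swap) (simp add: Bochner_Integration.integral_sum)
    also have "\<dots> \<le> (\<Sum>i\<in>{1..n}. B\<^sup>2 * C)"
    proof (rule sum_mono)
      fix i assume "i \<in> {1..n}"
      then have i: "i \<ge> 1" by simp
      have "expectation (\<lambda>\<omega>. (norm (T i \<omega>))\<^sup>2) \<le> expectation (\<lambda>\<omega>. B\<^sup>2 * (norm (noise i \<omega>))\<^sup>2)"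
        using noise_sq[OF i] T_sq[OF i]
        by (intro integral_mono T_bound[OF i]) (simp_all add: norm_power2_vec[of "T _ _"])
      also have "\<dots> \<le> B\<^sup>2 * C" using C[OF i] by (simp add: mult_left_mono)
      finally show "expectation (\<lambda>\<omega>. (norm (T i \<omega>))\<^sup>2) \<le> B\<^sup>2 * C" .
    qed
    finally show ?thesis using n by (simp add: mult_left_mono divide_simps)
  qed
  ultimately show ?thesis using that by blast
qed

text \<open>Markov's inequality for the squared norm. The 1 added to \<open>\<bar>C\<bar>\<close>
  keeps S positive.\<close>

lemma score_tight:
  assumes "\<epsilon> > 0"
  obtains S where "S > 0" "\<And>n. n \<ge> 1 \<Longrightarrow> prob {\<omega> \<in> space M. S \<le> norm (score \<nu> b X \<beta>\<^sub>0 y n \<omega>)} \<le> \<epsilon>"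
proof -
  obtain C where C: "\<And>n. n \<ge> 1 \<Longrightarrow> integrable M (\<lambda>\<omega>. (norm (score \<nu> b X \<beta>\<^sub>0 y n \<omega>))\<^sup>2)"
    "\<And>n. n \<ge> 1 \<Longrightarrow> expectation (\<lambda>\<omega>. (norm (score \<nu> b X \<beta>\<^sub>0 y n \<omega>))\<^sup>2) \<le> C"
    using score_second_moment_bounded by blast
  define S where "S = sqrt ((\<bar>C\<bar> + 1) / \<epsilon>)"
  have S: "S > 0" "S\<^sup>2 = (\<bar>C\<bar> + 1) / \<epsilon>" using assms by (auto simp: S_def add_nonneg_pos)
  have "prob {\<omega> \<in> space M. S \<le> norm (score \<nu> b X \<beta>\<^sub>0 y n \<omega>)} \<le> \<epsilon>" if n: "n \<ge> 1" for n
  proof -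
    have "{\<omega> \<in> space M. S \<le> norm (score \<nu> b X \<beta>\<^sub>0 y n \<omega>)}
        = {\<omega> \<in> space M. S\<^sup>2 \<le> (norm (score \<nu> b X \<beta>\<^sub>0 y n \<omega>))\<^sup>2}"
      using S(1) by (auto simp: abs_le_square_iff[symmetric])
    also have "prob \<dots> \<le> expectation (\<lambda>\<omega>. (norm (score \<nu> b X \<beta>\<^sub>0 y n \<omega>))\<^sup>2) / S\<^sup>2"
      using C(1)[OF n] S(1) by (intro integral_Markov_inequality_measure[where A = "{}"]) auto
    also have "\<dots> \<le> (\<bar>C\<bar> + 1) / S\<^sup>2"
      using C(2)[OF n] by (intro divide_right_mono) auto
    also have "\<dots> = \<epsilon>" using assms by (simp add: S(2))
    finally show ?thesis .
  qed
  then show ?thesis using that S(1) by blast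
qed

end

end

section \<open>The bridge estimator\<close>

context bridge_glm
begin

text \<open>Eventually the bad event is contained in the event of a large score, whose probability
  is small uniformly in n.\<close>

lemma estimator_limit:
  fixes M :: "'w measure" and y :: "nat \<Rightarrow> 'w \<Rightarrow> real^'r"
  assumes M: "prob_space M" "prob_space.indep_vars M (\<lambda>_. borel) y {1..}"
    "\<And>i. i \<ge> 1 \<Longrightarrow> distributed M \<nu> (y i) (\<lambda>v. ennreal (nef_density \<nu> b (X i *v \<beta>\<^sub>0) v))"
    and est: "bridge_estimator M \<nu> b \<B> X \<gamma> (\<lambda>n. real n powr ((\<gamma>\<^sub>0 - 2) / 2) * lam) y est"
    and \<epsilon>: "\<epsilon> > 0"
  shows "(\<lambda>n. \<P>(\<omega> in M. \<not> (subvec J1 (est n \<omega>) = 0 \<and>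
    norm (sqrt (real n) *\<^sub>R (est n \<omega> - \<beta>\<^sub>0) - limit (score \<nu> b X \<beta>\<^sub>0 y n \<omega>)) \<le> \<epsilon>))) \<longlonglongrightarrow> 0"
    (is "(\<lambda>n. prob_space.prob M (?bad n)) \<longlonglongrightarrow> 0")
proof -
  interpret prob_space M by (rule M)
  show ?thesis
  proof (rule LIMSEQ_I)
    fix e :: real assume e: "e > 0"
    then obtain S where S: "S > 0" "\<And>n. n \<ge> 1 \<Longrightarrow> prob {\<omega> \<in> space M. S \<le> norm (score \<nu> b X \<beta>\<^sub>0 y n \<omega>)} \<le> e / 2"
      using score_tight[OF M, of "e / 2"] by auto
    have "eventually (\<lambda>n. norm (prob (?bad n) - 0) < e) sequentially"
      using minimizer_limit[OF \<epsilon>, of S] eventually_ge_at_top[of 1]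
    proof eventually_elim
      case (elim n)
      have good: "subvec J1 (est n \<omega>) = 0 \<and>
        norm (sqrt (real n) *\<^sub>R (est n \<omega> - \<beta>\<^sub>0) - limit (score \<nu> b X \<beta>\<^sub>0 y n \<omega>)) \<le> \<epsilon>"
        if \<omega>: "\<omega> \<in> space M" and s: "norm (score \<nu> b X \<beta>\<^sub>0 y n \<omega>) < S" for \<omega>
      proof -
        let ?s = "score \<nu> b X \<beta>\<^sub>0 y n \<omega>" and ?u = "sqrt (real n) *\<^sub>R (est n \<omega> - \<beta>\<^sub>0)"
        \<comment> \<open>Existence has to come before any claim on the estimator, which is
          prescribed only at outcomes admitting a minimizer.\<close>
        obtain u where "is_minimizer n ?s u" using elim(1) s by fastforce
        moreover have "u = sqrt (real n) *\<^sub>R ((\<beta>\<^sub>0 + (1 / sqrt (real n)) *\<^sub>R u) - \<beta>\<^sub>0)"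
          using elim(2) by simp
        ultimately have "is_minimizer n ?s (sqrt (real n) *\<^sub>R ((\<beta>\<^sub>0 + (1 / sqrt (real n)) *\<^sub>R u) - \<beta>\<^sub>0))"
          by simp
        then have "is_minimizer n ?s ?u"
          using est \<omega> unfolding bridge_estimator_def is_arg_min_bridge_objective[OF elim(2), symmetric]
          by blast
        then have *: "subvec J1 ?u = 0" "norm (?u - limit ?s) \<le> \<epsilon>" using elim(1) less_imp_le[OF s] by blast+
        have "subvec J1 ?u = sqrt (real n) *\<^sub>R (subvec J1 (est n \<omega>) - subvec J1 \<beta>\<^sub>0)"
          by (simp only: subvec_scaleR subvec_diff)
        moreover have "subvec J1 \<beta>\<^sub>0 = 0" by (auto simp: subvec_def J1_def vec_eq_iff)
        ultimately show ?thesis using * elim(2) by simp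
      qed
      \<comment> \<open>Monotonicity of the measure asks for measurability of the larger
        event.\<close>
      have "{\<omega> \<in> space M. S \<le> norm (score \<nu> b X \<beta>\<^sub>0 y n \<omega>)} \<in> sets M"
        using score_measurable[OF M, of n] by measurable
      then have "prob (?bad n) \<le> prob {\<omega> \<in> space M. S \<le> norm (score \<nu> b X \<beta>\<^sub>0 y n \<omega>)}"
        using good by (intro finite_measure_mono) (auto simp: not_le[symmetric])
      then show ?case using S(2)[OF elim(2)] e by simp
    qed
    then show "\<exists>no. \<forall>n\<ge>no. norm (prob (?bad n) - 0) < e" by (simp add: eventually_sequentially)
  qed
qed

theorem bridge_oracle:
  fixes M :: "'w measure" and y :: "nat \<Rightarrow> 'w \<Rightarrow> real^'r"
  assumes M: "prob_space M" "prob_space.indep_vars M (\<lambda>_. borel) y {1..}"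
    "\<And>i. i \<ge> 1 \<Longrightarrow> distributed M \<nu> (y i) (\<lambda>v. ennreal (nef_density \<nu> b (X i *v \<beta>\<^sub>0) v))"
    and est: "bridge_estimator M \<nu> b \<B> X \<gamma> (\<lambda>n. real n powr ((\<gamma>\<^sub>0 - 2) / 2) * lam) y est"
  shows "(\<lambda>n. \<P>(\<omega> in M. subvec J1 (est n \<omega>) = 0)) \<longlonglongrightarrow> 1"
    and "small_op_one M (\<lambda>n \<omega>. sqrt (real n) *\<^sub>R (subvec J2 (est n \<omega>) - subvec J2 \<beta>\<^sub>0)
          - limit (score \<nu> b X \<beta>\<^sub>0 y n \<omega>))"
proof -
  interpret prob_space M by (rule M)
  have [measurable]: "est n \<in> borel_measurable M" for n using est by (simp add: bridge_estimator_def)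
  note [measurable] = score_measurable[OF M]
  have [measurable]: "limit \<in> borel_measurable borel" unfolding limit_def by measurable
  let ?bad = "\<lambda>\<epsilon> n. {\<omega> \<in> space M. \<not> (subvec J1 (est n \<omega>) = 0 \<and>
    norm (sqrt (real n) *\<^sub>R (est n \<omega> - \<beta>\<^sub>0) - limit (score \<nu> b X \<beta>\<^sub>0 y n \<omega>)) \<le> \<epsilon>)}"
  have bad_sets: "?bad \<epsilon> n \<in> sets M" for \<epsilon> n by measurable
  have lim: "(\<lambda>n. prob (?bad \<epsilon> n)) \<longlonglongrightarrow> 0" if "\<epsilon> > 0" for \<epsilon>
    using estimator_limit[OF M est that] .
  show "(\<lambda>n. \<P>(\<omega> in M. subvec J1 (est n \<omega>) = 0)) \<longlonglongrightarrow> 1"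
  proof (rule real_tendsto_sandwich[where h = "\<lambda>_. 1"])
    show "(\<lambda>n. 1 - prob (?bad 1 n)) \<longlonglongrightarrow> 1" using tendsto_diff[OF tendsto_const lim[of 1], of 1] by simp
    show "\<forall>\<^sub>F n in sequentially. 1 - prob (?bad 1 n) \<le> \<P>(\<omega> in M. subvec J1 (est n \<omega>) = 0)"
    proof (intro always_eventually allI)
      fix n
      have "1 - prob (?bad 1 n) = prob (space M - ?bad 1 n)" using prob_compl[OF bad_sets] by simp
      also have "\<dots> \<le> \<P>(\<omega> in M. subvec J1 (est n \<omega>) = 0)"
        by (intro finite_measure_mono) auto
      finally show "1 - prob (?bad 1 n) \<le> \<P>(\<omega> in M. subvec J1 (est n \<omega>) = 0)" .
    qed
  qed (auto intro: always_eventually)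
  show "small_op_one M (\<lambda>n \<omega>. sqrt (real n) *\<^sub>R (subvec J2 (est n \<omega>) - subvec J2 \<beta>\<^sub>0)
          - limit (score \<nu> b X \<beta>\<^sub>0 y n \<omega>))"
    unfolding small_op_one_def
  proof (intro allI impI)
    fix \<epsilon> :: real assume "\<epsilon> > 0"
    note lim = lim[OF this]
    show "(\<lambda>n. \<P>(\<omega> in M. \<epsilon> < norm (sqrt (real n) *\<^sub>R (subvec J2 (est n \<omega>) - subvec J2 \<beta>\<^sub>0)
          - limit (score \<nu> b X \<beta>\<^sub>0 y n \<omega>)))) \<longlonglongrightarrow> 0"
    proof (rule real_tendsto_sandwich[OF _ _ tendsto_const lim])
      show "\<forall>\<^sub>F n in sequentially. \<P>(\<omega> in M. \<epsilon> < norm (sqrt (real n) *\<^sub>R (subvec J2 (est n \<omega>) - subvec J2 \<beta>\<^sub>0)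
          - limit (score \<nu> b X \<beta>\<^sub>0 y n \<omega>))) \<le> prob (?bad \<epsilon> n)"
      proof (intro always_eventually allI finite_measure_mono subsetI)
        fix n \<omega>
        assume \<omega>: "\<omega> \<in> {\<omega> \<in> space M. \<epsilon> < norm (sqrt (real n) *\<^sub>R (subvec J2 (est n \<omega>) - subvec J2 \<beta>\<^sub>0)
          - limit (score \<nu> b X \<beta>\<^sub>0 y n \<omega>))}"
        \<comment> \<open>The true parameter is supported in \<open>J2\<close>, and off the bad
          event so is the estimate; passing to subvectors then changes nothing.\<close>
        have "subvec J2 \<beta>\<^sub>0 = \<beta>\<^sub>0" by (auto simp: subvec_def J2_def vec_eq_iff)
        moreover have "subvec J2 (est n \<omega>) = est n \<omega>" if "subvec J1 (est n \<omega>) = 0"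
          using split_subvec[of "est n \<omega>"] that by simp
        ultimately show "\<omega> \<in> ?bad \<epsilon> n" using \<omega> by auto
      qed (rule bad_sets)
    qed (auto intro: always_eventually)
  qed
qed

end

theorem theorem5:
  fixes M :: "'w measure"
    and \<nu> :: "(real^'r) measure" and b :: "real^'r \<Rightarrow> real"
    and \<B> :: "(real^'p) set" and \<beta>\<^sub>0 :: "real^'p"
    and \<X> :: "(real^'p^'r) set" and X :: "nat \<Rightarrow> real^'p^'r" and \<mu> :: "(real^'p^'r) measure"
    and y :: "nat \<Rightarrow> 'w \<Rightarrow> real^'r" and est :: "nat \<Rightarrow> 'w \<Rightarrow> real^'p"
    and \<gamma> \<gamma>\<^sub>0 lam :: real
  defines "J1 \<equiv> {j. \<beta>\<^sub>0 $ j = 0}" and "J2 \<equiv> {j. \<beta>\<^sub>0 $ j \<noteq> 0}"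
    and "J \<equiv> info_matrix \<nu> b \<mu> \<beta>\<^sub>0"
    and "s \<equiv> score \<nu> b X \<beta>\<^sub>0 y"
    and "\<eta>' \<equiv> (\<chi> j. \<gamma> * sgn (\<beta>\<^sub>0 $ j) * \<bar>\<beta>\<^sub>0 $ j\<bar> powr (\<gamma> - 1))"
  assumes "prob_space M"
    and "sigma_finite_measure \<nu>" and "sets \<nu> = sets borel" and "b \<in> borel_measurable borel"
    and "\<forall>\<theta>\<in>interior (natural_parameter_space \<nu> b). pos_def (hessian (cumulant \<nu> b) \<theta>)"
    and "open \<B>" and "convex \<B>" and "\<beta>\<^sub>0 \<in> \<B>"
    and "\<forall>i\<ge>1. X i \<in> \<X>"
    and "prob_space.indep_vars M (\<lambda>_. borel) y {1..}"
    and "\<forall>i\<ge>1. distributed M \<nu> (y i) (\<lambda>v. ennreal (nef_density \<nu> b (X i *v \<beta>\<^sub>0) v))"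
    and "cond_C1 \<nu> b \<B> \<X>" and "cond_C2 \<nu> b \<B> \<X> X \<mu>"
    and "0 < \<gamma>" and "\<gamma> < 1" and "\<gamma> < \<gamma>\<^sub>0" and "\<gamma>\<^sub>0 \<le> 1" and "0 < lam"
    and "bridge_estimator M \<nu> b \<B> X \<gamma> (\<lambda>n. real n powr ((\<gamma>\<^sub>0 - 2) / 2) * lam) y est"
  shows "(\<lambda>n. \<P>(\<omega> in M. subvec J1 (est n \<omega>) = 0)) \<longlonglongrightarrow> 1 \<and>
    (\<gamma>\<^sub>0 < 1 \<longrightarrow>
      small_op_one M (\<lambda>n \<omega>.
        sqrt (real n) *\<^sub>R (subvec J2 (est n \<omega>) - subvec J2 \<beta>\<^sub>0)
          - submat_inv J2 J *v subvec J2 (s n \<omega>))) \<and>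
    (\<gamma>\<^sub>0 = 1 \<longrightarrow>
      small_op_one M (\<lambda>n \<omega>.
        sqrt (real n) *\<^sub>R (subvec J2 (est n \<omega>) - subvec J2 \<beta>\<^sub>0)
          - submat_inv J2 J *v (subvec J2 (s n \<omega>) - lam *\<^sub>R subvec J2 \<eta>')))"
proof -
  interpret B: bridge_glm \<nu> b \<B> \<beta>\<^sub>0 \<X> X J \<gamma> \<gamma>\<^sub>0 lam
    using assms(6-) by unfold_locales (auto simp: J_def cond_C1_def cond_C2_def)
  have J12: "B.J1 = J1" "B.J2 = J2" by (simp_all add: B.J1_def B.J2_def J1_def J2_def)
  note lims = B.bridge_oracle[OF assms(6) assms(15) assms(16)[rule_format] assms(24), unfolded J12 s_def[symmetric]]
  show ?thesis
  proof (intro conjI impI)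
    assume "\<gamma>\<^sub>0 < 1"
    \<comment> \<open>Below the boundary case the penalty slope at nonzero coordinates tends to 0,
      so the bias is 0.\<close>
    then have "B.limit v = submat_inv J2 J *v subvec J2 v" for v
      by (simp add: B.limit_def B.bias_def J12)
    then show "small_op_one M (\<lambda>n \<omega>. sqrt (real n) *\<^sub>R (subvec J2 (est n \<omega>) - subvec J2 \<beta>\<^sub>0)
          - submat_inv J2 J *v subvec J2 (s n \<omega>))"
      using lims(2) by simp
  next
    assume "\<gamma>\<^sub>0 = 1"
    then have "B.bias = lam *\<^sub>R \<eta>'" unfolding B.bias_def B.\<eta>_def \<eta>'_def by simp
    then have "B.limit v = submat_inv J2 J *v (subvec J2 v - lam *\<^sub>R subvec J2 \<eta>')" for v
      unfolding B.limit_def J12 by (simp only: subvec_diff subvec_scaleR)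
    then show "small_op_one M (\<lambda>n \<omega>. sqrt (real n) *\<^sub>R (subvec J2 (est n \<omega>) - subvec J2 \<beta>\<^sub>0)
          - submat_inv J2 J *v (subvec J2 (s n \<omega>) - lam *\<^sub>R subvec J2 \<eta>'))"
      using lims(2) by simp
  qed (rule lims(1))
qed

end
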